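(* Let $n\ge 2$ and $M=\{m_1<m_2<\dots<m_t\}\subseteq[0,n-1]$, and put $m_{t+1}:=n$. Let $D(M)=\{\gamma\in D_n\mid \operatorname{Des}_D(\gamma^{-1})\subseteq M\}$ and $C=\begin{bmatrix} n\\ m_1,\ m_2-m_1,\ \dots,\ n-m_t\end{bmatrix}_q$. Then $$\sum_{\gamma\in D(M)} q^{\operatorname{dmaj}(\gamma)}=\sum_{\gamma\in D(M)} q^{\ell_D(\gamma)}=\begin{cases} C\prod_{i=1}^{n-1}(1+q^i) & \text{if } 0\in M,\\ C\prod_{i=m_1}^{n-1}(1+q^i) & \text{if } 0\notin M,\ 1\notin M,\\ C\,\dfrac{\prod_{i=1}^{n-1}(1+q^i)}{[m_2]_q} & \text{if } 0\notin M,\ 1\in M.\end{cases}$$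
   Context: $B_n$ is the group of bijections $\beta$ of $[-n,n]\setminus\{0\}$ with $\beta(-i)=-\beta(i)$, composed as functions, in window notation $[\beta(1),\dots,\beta(n)]$; $D_n\subseteq B_n$ is the subgroup of those with an even number of negative entries among $\beta(1),\dots,\beta(n)$. For $\gamma\in D_n$: $\operatorname{Des}_D(\gamma)=\{i\in[0,n-1]\mid\gamma(i)>\gamma(i+1)\}$ with $\gamma(0):=-\gamma(2)$; $\operatorname{Des}(\gamma)=\{i\in[n-1]\mid\gamma(i)>\gamma(i+1)\}$, $\operatorname{maj}(\gamma)=\sum_{i\in\operatorname{Des}(\gamma)}i$; $\operatorname{inv}(\gamma)=|\{(i,j):1\le i<j\le n,\gamma(i)>\gamma(j)\}|$; $\operatorname{N}_2(\gamma)=|\{\{i,j\}\subseteq[n],i\ne j:\gamma(i)+\gamma(j)<0\}|$. $\ell_D(\gamma)=\operatorname{inv}(\gamma)+\operatorname{N}_2(\gamma)$ (the Coxeter length of type $D$) and $\operatorname{dmaj}(\gamma)=\operatorname{maj}(\gamma)+\operatorname{N}_2(\gamma)$. $[k]_q=1+q+\dots+q^{k-1}$, $[k]_q!=[k]_q\cdots[1]_q$ ($[0]_q!=1$), $\begin{bmatrix} n\\ a_1,\dots,a_s\end{bmatrix}_q=\frac{[n]_q!}{[a_1]_q!\cdots[a_s]_q!}$. *)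

theory Defs
  imports
    "HOL-Combinatorics.Permutations"
    "HOL-Computational_Algebra.Polynomial"
    "HOL-Computational_Algebra.Fraction_Field"
begin

text \<open>Elements of the signed permutation group are functions on all of \<open>int\<close>, fixing every
  point outside the set they permute; the group operations are then \<open>\<circ>\<close> and \<open>inv\<close>.\<close>

definition B_group :: "nat \<Rightarrow> (int \<Rightarrow> int) set" where
  "B_group n = {\<beta>. \<beta> permutes ({- int n..int n} - {0}) \<and>
                    (\<forall>i\<in>{- int n..int n} - {0}. \<beta> (- i) = - \<beta> i)}"

definition D_group :: "nat \<Rightarrow> (int \<Rightarrow> int) set" where
  "D_group n = {\<gamma>\<in>B_group n. even (card {i\<in>{1..n}. \<gamma> (int i) < 0})}"

text \<open>The convention \<open>\<gamma>(0) := -\<gamma>(2)\<close> is local to type D descents; the underlying function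
  satisfies \<open>\<gamma> 0 = 0\<close>.\<close>

definition Des_D :: "nat \<Rightarrow> (int \<Rightarrow> int) \<Rightarrow> nat set" where
  "Des_D n \<gamma> = {i\<in>{0..n-1}. (if i = 0 then - \<gamma> 2 else \<gamma> (int i)) > \<gamma> (int (i + 1))}"

definition Des :: "nat \<Rightarrow> (int \<Rightarrow> int) \<Rightarrow> nat set" where
  "Des n \<gamma> = {i\<in>{1..n-1}. \<gamma> (int i) > \<gamma> (int (i + 1))}"

definition maj :: "nat \<Rightarrow> (int \<Rightarrow> int) \<Rightarrow> nat" where
  "maj n \<gamma> = (\<Sum>i\<in>Des n \<gamma>. i)"

definition inversion_number :: "nat \<Rightarrow> (int \<Rightarrow> int) \<Rightarrow> nat" where
  "inversion_number n \<gamma> = card {(i, j). 1 \<le> i \<and> i < j \<and> j \<le> n \<and> \<gamma> (int i) > \<gamma> (int j)}"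

definition N2 :: "nat \<Rightarrow> (int \<Rightarrow> int) \<Rightarrow> nat" where
  "N2 n \<gamma> = card {{i, j} |i j. i \<in> {1..n} \<and> j \<in> {1..n} \<and> i \<noteq> j \<and> \<gamma> (int i) + \<gamma> (int j) < 0}"

definition length_D :: "nat \<Rightarrow> (int \<Rightarrow> int) \<Rightarrow> nat" where
  "length_D n \<gamma> = inversion_number n \<gamma> + N2 n \<gamma>"

definition dmaj :: "nat \<Rightarrow> (int \<Rightarrow> int) \<Rightarrow> nat" where
  "dmaj n \<gamma> = maj n \<gamma> + N2 n \<gamma>"

definition D_of :: "nat \<Rightarrow> nat set \<Rightarrow> (int \<Rightarrow> int) set" where
  "D_of n M = {\<gamma>\<in>D_group n. Des_D n (inv \<gamma>) \<subseteq> M}"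

definition q_int :: "'a::field \<Rightarrow> nat \<Rightarrow> 'a" where
  "q_int q k = (\<Sum>i<k. q ^ i)"

definition q_fact :: "'a::field \<Rightarrow> nat \<Rightarrow> 'a" where
  "q_fact q k = (\<Prod>i=1..k. q_int q i)"

definition q_multinomial :: "'a::field \<Rightarrow> nat \<Rightarrow> nat list \<Rightarrow> 'a" where
  "q_multinomial q n as = q_fact q n / (\<Prod>a\<leftarrow>as. q_fact q a)"

text \<open>The indeterminate \<open>q\<close>, in the fraction field of the polynomial ring over the integers, so
  that the quotients of \<open>q\<close>-factorials are honest quotients.\<close>

definition q_var :: "int poly fract" where
  "q_var = Fract [:0, 1:] 1"

end

theory Submission
  imports Defs "HOL-Library.FuncSet" "HOL-Library.Disjoint_Sets"
begin

text \<open>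
  An element of \<open>B_n\<close> is determined by the set \<open>S\<close> of absolute values it negates and by its window,
  a word in the letters \<open>\<plusminus>b\<close> whose signs are prescribed by \<open>S\<close>. Of the two summands of \<open>dmaj\<close> and of the
  length, \<open>N2\<close> only depends on \<open>S\<close>: it is the sum of \<open>b - 1\<close> over \<open>b \<in> S\<close>. For fixed \<open>S\<close> the
  condition on the descents of the inverse says that certain values, adjacent in the sorted window,
  occur in increasing order. By MacMahon's theorem \<open>maj\<close> and \<open>inv\<close> have the same generating function on such a
  set of words, a \<open>q\<close>-multinomial coefficient.

  Summing over the admissible \<open>S\<close>, with weight \<open>s\<close> for every negation, the \<open>q\<close>-binomial theorem
  gives a product that vanishes for \<open>s = -1\<close>, so \<open>D_n\<close> contributes exactly half of the value at
  \<open>s = 1\<close>. The case \<open>0 \<notin> M\<close>, \<open>1 \<in> M\<close> reduces to \<open>0 \<in> M\<close>, \<open>1 \<notin> M\<close> by changing the sign of the value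
  \<open>1\<close>, which affects neither statistic.
\<close>

section \<open>Words increasing on blocks\<close>

lemma q_int_0 [simp]: "q_int q 0 = 0"
  by (simp add: q_int_def)

lemma q_int_Suc: "q_int q (Suc k) = q_int q k + q ^ k"
  by (simp add: q_int_def)

lemma q_int_add: "q_int q (a + b) = q_int q a + q ^ a * q_int q b"
  by (induction b) (simp_all add: q_int_Suc algebra_simps power_add)

lemma q_fact_0 [simp]: "q_fact q 0 = 1"
  by (simp add: q_fact_def)

lemma q_fact_Suc: "q_fact q (Suc k) = q_int q (Suc k) * q_fact q k"
  by (simp add: q_fact_def mult.commute)

lemma q_fact_nonzero:
  assumes "\<And>k. k > 0 \<Longrightarrow> q_int q k \<noteq> 0"
  shows "q_fact q k \<noteq> 0"
  using assms by (simp add: q_fact_def)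

section \<open>Words with increasing fibres, built up by their last letter\<close>

definition block_words :: "('a::linorder \<Rightarrow> 'b) \<Rightarrow> 'a set \<Rightarrow> 'a list set" where
  "block_words f V = {w. set w = V \<and> distinct w \<and> sorted_wrt (\<lambda>x y. f x = f y \<longrightarrow> x < y) w}"

text \<open>The candidates for the last letter of a block word.\<close>

definition block_max :: "('a::linorder \<Rightarrow> 'b) \<Rightarrow> 'a set \<Rightarrow> 'a set" where
  "block_max f V = {x\<in>V. \<forall>y\<in>V. f y = f x \<longrightarrow> y \<le> x}"

definition num_above :: "'a::linorder set \<Rightarrow> 'a \<Rightarrow> nat" where
  "num_above V x = card {y\<in>V. x < y}"

text \<open>Lists are indexed from \<open>0\<close>, so a descent between the entries
  \<open>i - 1\<close> and \<open>i\<close> is the descent at position \<open>i\<close> of the usual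
  count.\<close>

definition list_maj :: "'a::linorder list \<Rightarrow> nat" where
  "list_maj w = \<Sum>{i\<in>{1..<length w}. w ! (i - 1) > w ! i}"

definition list_inv :: "'a::linorder list \<Rightarrow> nat" where
  "list_inv w = card {(i, j). i < j \<and> j < length w \<and> w ! i > w ! j}"

text \<open>Meant for a finite \<open>K\<close> that contains all labels of \<open>V\<close>. A
  label that does not occur contributes \<open>q_fact q 0 = 1\<close>, so \<open>K\<close> can stay
  fixed while letters are removed from \<open>V\<close>.\<close>

definition block_multinomial :: "'q::field \<Rightarrow> 'b set \<Rightarrow> ('a \<Rightarrow> 'b) \<Rightarrow> 'a set \<Rightarrow> 'q" where
  "block_multinomial q K f V = q_fact q (card V) / (\<Prod>k\<in>K. q_fact q (card {y\<in>V. f y = k}))"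

lemma finite_block_words: "finite V \<Longrightarrow> finite (block_words f V)"
  by (rule finite_subset[of _ "{w. set w \<subseteq> V \<and> length w \<le> card V}"])
    (auto simp: block_words_def distinct_card finite_lists_length_le)

lemma block_words_empty [simp]: "block_words f {} = {[]}"
  by (auto simp: block_words_def)

lemma length_block_words: "w \<in> block_words f V \<Longrightarrow> length w = card V"
  by (auto simp: block_words_def distinct_card)

text \<open>The words are the linear extensions of a disjoint union of chains, the fibres of
  \<open>f\<close>. The last letter is therefore the top of its chain, and deleting it leaves a word
  of the same kind.\<close>

lemma block_words_snoc:
  assumes "V \<noteq> {}"
  shows "block_words f V = (\<Union>x\<in>block_max f V. (\<lambda>w. w @ [x]) ` block_words f (V - {x}))"
proof (intro equalityI subsetI)
  fix w assume w: "w \<in> block_words f V"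
  with assms have "w \<noteq> []" by (auto simp: block_words_def)
  then obtain u x where "w = u @ [x]" by (metis rev_exhaust)
  with w have "x \<in> block_max f V" "u \<in> block_words f (V - {x})"
    by (auto simp: block_words_def block_max_def sorted_wrt_append less_imp_le)
  with \<open>w = u @ [x]\<close> show "w \<in> (\<Union>x\<in>block_max f V. (\<lambda>w. w @ [x]) ` block_words f (V - {x}))"
    by auto
next
  fix w assume "w \<in> (\<Union>x\<in>block_max f V. (\<lambda>w. w @ [x]) ` block_words f (V - {x}))"
  then show "w \<in> block_words f V"
    by (auto simp: block_words_def block_max_def sorted_wrt_append order.strict_iff_order)
qed

lemma sum_block_words:
  assumes "finite V" "V \<noteq> {}"
  shows "(\<Sum>w\<in>block_words f V. g w) = (\<Sum>x\<in>block_max f V. \<Sum>w\<in>block_words f (V - {x}). g (w @ [x]))"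
proof -
  have "finite (block_max f V)"
    using assms by (auto simp: block_max_def)
  then show ?thesis
    unfolding block_words_snoc[OF assms(2), of f]
    by (subst sum.UNION_disjoint)
      (auto simp: assms finite_block_words sum.reindex inj_on_def)
qed

lemma list_maj_snoc:
  "list_maj (w @ [x]) = list_maj w + (if w \<noteq> [] \<and> last w > x then length w else 0)"
proof -
  have "{i\<in>{1..<length (w @ [x])}. (w @ [x]) ! (i - 1) > (w @ [x]) ! i} =
    {i\<in>{1..<length w}. w ! (i - 1) > w ! i} \<union> (if w \<noteq> [] \<and> last w > x then {length w} else {})"
    by (cases w rule: rev_cases) (auto simp: nth_append less_Suc_eq)
  then show ?thesis
    by (simp add: list_maj_def)
qed

text \<open>The new inversions are those that end in the appended letter, one for every greater
  letter of \<open>w\<close>; distinctness lets letters be counted in place of positions.\<close>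

lemma list_inv_snoc:
  assumes "distinct w"
  shows "list_inv (w @ [x]) = list_inv w + num_above (set w) x"
proof -
  let ?A = "{(i, j). i < j \<and> j < length w \<and> w ! i > w ! j}"
  let ?B = "{i. i < length w \<and> w ! i > x}"
  have "{(i, j). i < j \<and> j < length (w @ [x]) \<and> (w @ [x]) ! i > (w @ [x]) ! j} = ?A \<union> ?B \<times> {length w}"
    by (auto simp: nth_append less_Suc_eq split: if_splits)
  moreover have "finite ?A"
    by (rule finite_subset[of _ "{..length w} \<times> {..length w}"]) auto
  moreover have "?A \<inter> ?B \<times> {length w} = {}"
    by auto
  ultimately have "list_inv (w @ [x]) = list_inv w + card ?B"
    by (simp add: list_inv_def card_Un_disjoint card_cartesian_product)
  moreover have "bij_betw (\<lambda>i. w ! i) ?B {y\<in>set w. x < y}"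
    using assms by (auto simp: bij_betw_def inj_on_def nth_eq_iff_index_eq in_set_conv_nth image_iff)
  ultimately show ?thesis
    by (simp add: num_above_def bij_betw_same_card)
qed

text \<open>\<open>num_above V\<close> numbers the elements of \<open>V\<close> from the top,
  starting at \<open>0\<close>.\<close>

lemma sum_power_num_above:
  fixes q :: "'q::field"
  assumes "finite V"
  shows "(\<Sum>x\<in>V. q ^ num_above V x) = q_int q (card V)"
  using assms
proof (induction rule: finite_linorder_min_induct)
  case (insert b A)
  have "{y\<in>insert b A. b < y} = A" using insert by auto
  moreover have "{y\<in>insert b A. x < y} = {y\<in>A. x < y}" if "x \<in> A" for x
    using insert that by auto
  moreover have "b \<notin> A" using insert by auto
  ultimately show ?case
    using insert by (simp add: num_above_def q_int_Suc)
qed simp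

lemma block_max_inj: "inj_on f (block_max f V)"
  by (auto simp: inj_on_def block_max_def intro: antisym)

lemma block_max_image:
  assumes "finite V"
  shows "f ` block_max f V = f ` V"
proof (intro equalityI subsetI)
  fix k assume "k \<in> f ` V"
  then have *: "{y\<in>V. f y = k} \<noteq> {}" "finite {y\<in>V. f y = k}" using assms by auto
  then have "Max {y\<in>V. f y = k} \<in> {y\<in>V. f y = k}" by (intro Max_in)
  moreover from this * have "Max {y\<in>V. f y = k} \<in> block_max f V"
    by (auto simp: block_max_def)
  ultimately show "k \<in> f ` block_max f V" by force
qed (auto simp: block_max_def)

text \<open>A block maximum has nothing above it in its own fibre, so comparing with
  \<open>x\<close> amounts to comparing labels.\<close>

lemma above_block_max:
  assumes "x \<in> block_max f V" "mono_on V f" "y \<in> V"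
  shows "x < y \<longleftrightarrow> (f x < (f y :: 'b::linorder))"
proof
  assume "x < y"
  with assms have "f x \<le> f y" "f x \<noteq> f y"
    by (auto simp: block_max_def monotone_on_def dest: less_imp_le)
  then show "f x < f y" by simp
next
  assume "f x < f y"
  then have "\<not> f y \<le> f x" by simp
  then show "x < y"
    using assms by (auto simp: block_max_def monotone_on_def not_le[symmetric])
qed

text \<open>By monotonicity each fibre is an interval of \<open>V\<close>. The powers of
  \<open>q\<close> over one fibre, ranked in all of \<open>V\<close>, add up to the power of its top
  letter times the q-integer of its size; all fibres together give the q-integer of
  \<open>card V\<close>. The counts by inv and by maj both rest on this identity.\<close>

lemma sum_block_max:
  fixes f :: "'a::linorder \<Rightarrow> 'b::linorder" and q :: "'q::field"
  assumes "finite V" "mono_on V f"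
  shows "(\<Sum>x\<in>block_max f V. q ^ num_above V x * q_int q (card {y\<in>V. f y = f x})) = q_int q (card V)"
proof -
  have *: "q ^ num_above V x * q_int q (card {y\<in>V. f y = f x}) = (\<Sum>z\<in>{y\<in>V. f y = f x}. q ^ num_above V z)"
    if x: "x \<in> block_max f V" for x
  proof -
    let ?B = "{y\<in>V. f y = f x}"
    have "num_above V z = num_above V x + num_above ?B z" if z: "z \<in> ?B" for z
    proof -
      have "z \<le> x" using x z by (auto simp: block_max_def)
      have "f y = f x" if "y \<in> V" "z < y" "\<not> x < y" for y
      proof (rule antisym)
        show "f y \<le> f x" using above_block_max[OF x assms(2)] that by auto
        show "f x \<le> f y" using z that assms(2) by (auto simp: monotone_on_def)
      qed
      with \<open>z \<le> x\<close> have "{y\<in>V. z < y} = {y\<in>V. x < y} \<union> {y\<in>?B. z < y}"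
        by auto
      moreover have "{y\<in>V. x < y} \<inter> {y\<in>?B. z < y} = {}"
        using x by (auto simp: block_max_def)
      ultimately show ?thesis
        using assms(1) by (simp add: num_above_def card_Un_disjoint)
    qed
    then have "(\<Sum>z\<in>?B. q ^ num_above V z) = (\<Sum>z\<in>?B. q ^ num_above V x * q ^ num_above ?B z)"
      by (intro sum.cong) (auto simp: power_add)
    also have "\<dots> = q ^ num_above V x * q_int q (card ?B)"
      using assms(1) by (simp add: sum_power_num_above flip: sum_distrib_left)
    finally show ?thesis by simp
  qed
  have "(\<Sum>x\<in>block_max f V. q ^ num_above V x * q_int q (card {y\<in>V. f y = f x}))
      = (\<Sum>x\<in>block_max f V. \<Sum>z\<in>{y\<in>V. f y = f x}. q ^ num_above V z)"
    by (rule sum.cong[OF refl *])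
  also have "\<dots> = (\<Sum>k\<in>f ` block_max f V. \<Sum>z\<in>{y\<in>V. f y = k}. q ^ num_above V z)"
    by (simp add: sum.reindex[OF block_max_inj] o_def)
  also have "\<dots> = (\<Sum>z\<in>V. q ^ num_above V z)"
    unfolding block_max_image[OF assms(1)] using assms(1) by (intro sum.group) auto
  finally show ?thesis
    using sum_power_num_above[OF assms(1), of q] by simp
qed

text \<open>Removing \<open>x\<close> takes the factor \<open>q_int q (card V)\<close> from the
  numerator and the q-integer of the size of its fibre from the denominator.\<close>

lemma block_multinomial_remove:
  fixes q :: "'q::field"
  assumes nz: "\<And>k. k > 0 \<Longrightarrow> q_int q k \<noteq> 0"
    and "finite V" "finite K" "x \<in> V" "f x \<in> K"
  shows "q_int q (card V) * block_multinomial q K f (V - {x}) =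
         q_int q (card {y\<in>V. f y = f x}) * block_multinomial q K f V"
proof -
  let ?B = "{y\<in>V. f y = f x}"
  obtain c where c: "card V = Suc c" "card (V - {x}) = c"
    using assms by (metis card.remove)
  have B: "{y\<in>V - {x}. f y = f x} = ?B - {x}" by auto
  have "finite ?B" "x \<in> ?B" using assms by auto
  then obtain b where b: "card ?B = Suc b" "card (?B - {x}) = b"
    by (metis card.remove)
  have rest: "(\<Prod>k\<in>K - {f x}. q_fact q (card {y\<in>V - {x}. f y = k})) = (\<Prod>k\<in>K - {f x}. q_fact q (card {y\<in>V. f y = k}))"
    by (intro prod.cong arg_cong[of _ _ "\<lambda>A. q_fact q (card A)"]) auto
  have "q_int q (Suc b) \<noteq> 0" using nz by simp
  then show ?thesis
    unfolding block_multinomial_def prod.remove[OF assms(3,5)] rest B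
    by (simp add: b c q_fact_Suc)
qed

text \<open>Induction on the number of letters: the last letter \<open>x\<close> contributes
  \<open>num_above V x\<close>, and after multiplication by \<open>q_int q (card V)\<close> the
  summands become those of \<open>sum_block_max\<close>.\<close>

theorem sum_list_inv_block_words:
  fixes f :: "'a::linorder \<Rightarrow> 'b::linorder" and q :: "'q::field"
  assumes nz: "\<And>k. k > 0 \<Longrightarrow> q_int q k \<noteq> 0"
    and "finite K" "finite V" "mono_on V f" "f ` V \<subseteq> K"
  shows "(\<Sum>w\<in>block_words f V. q ^ list_inv w) = block_multinomial q K f V"
  using assms(3-5)
proof (induction "card V" arbitrary: V)
  case 0
  then show ?case by (simp add: list_inv_def block_multinomial_def)
next
  case (Suc c)
  then have "V \<noteq> {}" by auto
  have "q_int q (card V) * (\<Sum>w\<in>block_words f V. q ^ list_inv w) =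
    (\<Sum>x\<in>block_max f V. q ^ num_above V x * q_int q (card {y\<in>V. f y = f x}) * block_multinomial q K f V)"
    unfolding sum_block_words[OF Suc.prems(1) \<open>V \<noteq> {}\<close>] sum_distrib_left
  proof (rule sum.cong[OF refl], unfold sum_distrib_left[symmetric])
    fix x assume x: "x \<in> block_max f V"
    then have xV: "x \<in> V" by (auto simp: block_max_def)
    have "(\<Sum>w\<in>block_words f (V - {x}). q ^ list_inv (w @ [x])) =
      (\<Sum>w\<in>block_words f (V - {x}). q ^ num_above V x * q ^ list_inv w)"
    proof (rule sum.cong[OF refl])
      fix w assume "w \<in> block_words f (V - {x})"
      then have "set w = V - {x}" "distinct w" by (auto simp: block_words_def)
      moreover have "{y\<in>V - {x}. x < y} = {y\<in>V. x < y}" by auto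
      ultimately show "q ^ list_inv (w @ [x]) = q ^ num_above V x * q ^ list_inv w"
        by (simp add: list_inv_snoc num_above_def power_add)
    qed
    also have "\<dots> = q ^ num_above V x * block_multinomial q K f (V - {x})"
      using Suc xV by (subst sum_distrib_left[symmetric], subst Suc.hyps(1)) (auto simp: monotone_on_def)
    finally show "q_int q (card V) * (\<Sum>w\<in>block_words f (V - {x}). q ^ list_inv (w @ [x])) =
      q ^ num_above V x * q_int q (card {y\<in>V. f y = f x}) * block_multinomial q K f V"
      using block_multinomial_remove[OF nz Suc.prems(1) assms(2) xV, of f] Suc.prems xV
      by (auto simp: algebra_simps image_subset_iff)
  qed
  also have "\<dots> = q_int q (card V) * block_multinomial q K f V"
    using sum_block_max[OF Suc.prems(1,2), of q] by (simp flip: sum_distrib_right)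
  finally show ?case
    using nz[of "card V"] Suc.hyps(2) by auto
qed

text \<open>Fixing the last letter makes the generating function of \<open>maj\<close> satisfy a closed recursion:
  the penultimate letter alone decides whether the last position is a descent.\<close>

lemma sum_list_maj_snoc:
  fixes f :: "'a::linorder \<Rightarrow> 'b::linorder" and q :: "'q::field"
  assumes nz: "\<And>k. k > 0 \<Longrightarrow> q_int q k \<noteq> 0"
    and "finite K" "finite V" "mono_on V f" "f ` V \<subseteq> K" "x \<in> block_max f V"
  shows "(\<Sum>w\<in>block_words f (V - {x}). q ^ list_maj (w @ [x])) =
    q ^ num_above V x * block_multinomial q K f (V - {x})"
  using assms(3-6)
proof (induction "card V" arbitrary: V x)
  case 0
  then show ?case by (auto simp: block_max_def)
next
  case (Suc c)
  define U where "U = V - {x}"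
  have xV: "x \<in> V" using Suc.prems by (auto simp: block_max_def)
  have U: "finite U" "mono_on U f" "f ` U \<subseteq> K" "card U = c"
    using Suc xV by (auto simp: U_def monotone_on_def)
  have above: "num_above V x = num_above U x"
    unfolding num_above_def U_def by (rule arg_cong[of _ _ card]) auto
  show ?case
  proof (cases "U = {}")
    case True
    have "num_above V x = 0"
      by (subst above) (simp add: True num_above_def)
    then show ?thesis using True
      by (simp add: U_def[symmetric] list_maj_def block_multinomial_def)
  next
    case False
    \<comment> \<open>\<open>H\<close> holds the penultimate letters that create a descent in front
      of \<open>x\<close>.\<close>
    define H where "H = {y\<in>U. x < y}"
    have H: "finite H" "mono_on H f" using U by (auto simp: H_def monotone_on_def)
    have cardH: "card H = num_above U x" by (simp add: H_def num_above_def)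
    \<comment> \<open>\<open>x\<close> is the greatest letter of its fibre in \<open>V\<close>, so
      \<open>H\<close> is an upper set of \<open>U\<close> made of whole fibres. Its block maxima
      and their weights are therefore inherited from \<open>U\<close>.\<close>
    have maxH: "{y\<in>block_max f U. x < y} = block_max f H"
    proof -
      have "x < z" if "y \<in> U" "z \<in> U" "f y = f z" "x < y" for y z
        using above_block_max[OF Suc.prems(4,2)] that by (auto simp: U_def)
      then have "y \<in> block_max f U" if "y \<in> block_max f H" for y
        using that unfolding block_max_def H_def by (simp, metis)
      moreover have "y \<in> block_max f H" if "y \<in> block_max f U" "x < y" for y
        using that unfolding block_max_def H_def by simp
      moreover have "x < y" if "y \<in> block_max f H" for y
        using that unfolding block_max_def H_def by simp
      ultimately show ?thesis by blast
    qed
    define G where "G y = q ^ num_above U y * q_int q (card {z\<in>U. f z = f y})" for y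
    have sumU: "(\<Sum>y\<in>block_max f U. G y) = q_int q (card U)"
      unfolding G_def using sum_block_max[OF U(1,2)] .
    have sumH: "(\<Sum>y\<in>block_max f H. G y) = q_int q (card H)"
    proof -
      have "G y = q ^ num_above H y * q_int q (card {z\<in>H. f z = f y})" if y: "y \<in> block_max f H" for y
      proof -
        have "{z\<in>U. y < z} = {z\<in>H. y < z}"
          using y by (auto simp: block_max_def H_def)
        moreover have "{z\<in>U. f z = f y} = {z\<in>H. f z = f y}"
          using y above_block_max[OF Suc.prems(4,2)] by (auto simp: block_max_def H_def U_def)
        ultimately show ?thesis by (simp add: G_def num_above_def)
      qed
      then show ?thesis using sum_block_max[OF H, of q] by simp
    qed
    have fin: "finite (block_max f U)" using U by (auto simp: block_max_def)
    \<comment> \<open>Now the penultimate letter \<open>y\<close> is fixed. The induction hypothesis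
      applies to \<open>U\<close> with last letter \<open>y\<close>, and a descent from
      \<open>y\<close> to \<open>x\<close> stands at position \<open>card U\<close>.\<close>
    have "q_int q (card U) * (\<Sum>w\<in>block_words f U. q ^ list_maj (w @ [x])) =
      (\<Sum>y\<in>block_max f U. (if x < y then q ^ card U else 1) * G y * block_multinomial q K f U)"
      unfolding sum_block_words[OF U(1) False] sum_distrib_left
    proof (rule sum.cong[OF refl], unfold sum_distrib_left[symmetric])
      fix y assume y: "y \<in> block_max f U"
      then have yU: "y \<in> U" by (auto simp: block_max_def)
      have "(\<Sum>w\<in>block_words f (U - {y}). q ^ list_maj ((w @ [y]) @ [x])) =
        (\<Sum>w\<in>block_words f (U - {y}). (if x < y then q ^ card U else 1) * q ^ list_maj (w @ [y]))"
      proof (rule sum.cong[OF refl])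
        fix w assume "w \<in> block_words f (U - {y})"
        then have "Suc (length w) = card U"
          using U(1) yU by (auto dest!: length_block_words) (metis card_gt_0_iff empty_iff Suc_pred)
        then show "q ^ list_maj ((w @ [y]) @ [x]) = (if x < y then q ^ card U else 1) * q ^ list_maj (w @ [y])"
          unfolding list_maj_snoc[of "w @ [y]"] by (simp add: power_add)
      qed
      also have "\<dots> = (if x < y then q ^ card U else 1) * (q ^ num_above U y * block_multinomial q K f (U - {y}))"
        using Suc.hyps(1)[of U y] U y by (simp flip: sum_distrib_left)
      finally show "q_int q (card U) * (\<Sum>w\<in>block_words f (U - {y}). q ^ list_maj ((w @ [y]) @ [x])) =
        (if x < y then q ^ card U else 1) * G y * block_multinomial q K f U"
        using block_multinomial_remove[OF nz U(1) assms(2) yU, of f] U(3) yU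
        by (auto simp: G_def algebra_simps image_subset_iff)
    qed
    also have "\<dots> = (\<Sum>y\<in>block_max f U. (if x < y then q ^ card U else 1) * G y) * block_multinomial q K f U"
      by (simp add: sum_distrib_right)
    \<comment> \<open>With u and h the sizes of \<open>U\<close> and \<open>H\<close>, the sum is
      [u] + (q^u - 1)[h]. The two ways of splitting [u + h] turn this into q^h [u].\<close>
    also have "(\<Sum>y\<in>block_max f U. (if x < y then q ^ card U else 1) * G y) = q ^ card H * q_int q (card U)"
    proof -
      have "(\<Sum>y\<in>block_max f U. (if x < y then q ^ card U else 1) * G y) + (\<Sum>y\<in>block_max f H. G y) =
        (\<Sum>y\<in>block_max f U. G y + (if x < y then q ^ card U * G y else 0))"
        unfolding maxH[symmetric] sum.inter_filter[OF fin] sum.distrib[symmetric]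
        by (intro sum.cong) auto
      also have "\<dots> = q_int q (card U) + q ^ card U * q_int q (card H)"
        unfolding sum.distrib sumU sumH[symmetric] maxH[symmetric] sum.inter_filter[OF fin] sum_distrib_left
        by (simp add: if_distrib cong: if_cong)
      also have "\<dots> = q_int q (card H) + q ^ card H * q_int q (card U)"
        by (metis add.commute q_int_add)
      finally show ?thesis by (simp add: sumH)
    qed
    finally show ?thesis
      using nz[of "card U"] False U(1) by (simp add: above cardH U_def[symmetric] card_gt_0_iff)
  qed
qed

text \<open>With the last letter fixed, maj already has the same generating function as inv, so the
  summation over last letters is the one carried out for inv.\<close>

theorem sum_list_maj_block_words:
  fixes f :: "'a::linorder \<Rightarrow> 'b::linorder" and q :: "'q::field"
  assumes nz: "\<And>k. k > 0 \<Longrightarrow> q_int q k \<noteq> 0"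
    and "finite K" "finite V" "mono_on V f" "f ` V \<subseteq> K"
  shows "(\<Sum>w\<in>block_words f V. q ^ list_maj w) = block_multinomial q K f V"
proof (cases "V = {}")
  case True
  then show ?thesis by (simp add: list_maj_def block_multinomial_def)
next
  case False
  have "q_int q (card V) * (\<Sum>w\<in>block_words f V. q ^ list_maj w) =
    (\<Sum>x\<in>block_max f V. q ^ num_above V x * q_int q (card {y\<in>V. f y = f x}) * block_multinomial q K f V)"
    unfolding sum_block_words[OF assms(3) False] sum_distrib_left
  proof (rule sum.cong[OF refl], unfold sum_distrib_left[symmetric])
    fix x assume x: "x \<in> block_max f V"
    then have xV: "x \<in> V" by (auto simp: block_max_def)
    then show "q_int q (card V) * (\<Sum>w\<in>block_words f (V - {x}). q ^ list_maj (w @ [x])) =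
      q ^ num_above V x * q_int q (card {y\<in>V. f y = f x}) * block_multinomial q K f V"
      using sum_list_maj_snoc[OF assms x] block_multinomial_remove[OF nz assms(3,2) xV, of f] assms(5)
      by (auto simp: algebra_simps image_subset_iff)
  qed
  also have "\<dots> = q_int q (card V) * block_multinomial q K f V"
    using sum_block_max[OF assms(3,4), of q] by (simp flip: sum_distrib_right)
  finally show ?thesis
    using nz[of "card V"] False assms(3) by (auto simp: card_gt_0_iff)
qed

section \<open>Sets of negated values\<close>

text \<open>Distributivity: a subset of a disjoint union is a free choice of its traces, and
  \<open>F i\<close> lists the traces allowed on \<open>A i\<close>.\<close>

lemma sum_prod_restrict_disjoint:
  fixes \<phi> :: "'i \<Rightarrow> 'a set \<Rightarrow> 'q::comm_semiring_1"
  assumes "finite I" "disjoint_family_on A I" "\<And>i. i \<in> I \<Longrightarrow> finite (A i)" "\<And>i. i \<in> I \<Longrightarrow> F i \<subseteq> Pow (A i)"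
  shows "(\<Sum>S | S \<subseteq> (\<Union>i\<in>I. A i) \<and> (\<forall>i\<in>I. S \<inter> A i \<in> F i). \<Prod>i\<in>I. \<phi> i (S \<inter> A i)) =
    (\<Prod>i\<in>I. \<Sum>T\<in>F i. \<phi> i T)"
proof -
  have inter: "(\<Union>j\<in>I. g j) \<inter> A i = g i" if "g \<in> Pi\<^sub>E I F" "i \<in> I" for g i
  proof -
    have "g j \<subseteq> A j" if "j \<in> I" for j
      using that assms(4)[of j] \<open>g \<in> Pi\<^sub>E I F\<close> by (auto simp: PiE_def Pi_def)
    moreover have "A i \<inter> A j = {}" if "j \<in> I" "j \<noteq> i" for j
      using assms(2) that \<open>i \<in> I\<close> by (auto simp: disjoint_family_on_def)
    ultimately show ?thesis using \<open>i \<in> I\<close> by blast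
  qed
  have "finite (F i)" if "i \<in> I" for i
    using assms(3,4)[OF that] by (meson finite_Pow_iff finite_subset)
  then have "(\<Prod>i\<in>I. \<Sum>T\<in>F i. \<phi> i T) = (\<Sum>g\<in>Pi\<^sub>E I F. \<Prod>i\<in>I. \<phi> i (g i))"
    by (intro prod_sum_PiE assms(1))
  also have "\<dots> = (\<Sum>S | S \<subseteq> (\<Union>i\<in>I. A i) \<and> (\<forall>i\<in>I. S \<inter> A i \<in> F i). \<Prod>i\<in>I. \<phi> i (S \<inter> A i))"
  proof (rule sum.reindex_bij_witness[of _ "\<lambda>S. \<lambda>i\<in>I. S \<inter> A i" "\<lambda>g. \<Union>i\<in>I. g i"])
    fix g assume g: "g \<in> Pi\<^sub>E I F"
    show "(\<lambda>i\<in>I. (\<Union>j\<in>I. g j) \<inter> A i) = g"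
      using g by (intro ext) (auto simp: inter PiE_def extensional_def restrict_def)
    show "(\<Union>i\<in>I. g i) \<in> {S. S \<subseteq> (\<Union>i\<in>I. A i) \<and> (\<forall>i\<in>I. S \<inter> A i \<in> F i)}"
      using g inter[OF g] assms(4) by (auto simp: PiE_def Pi_def)
    show "(\<Prod>i\<in>I. \<phi> i ((\<Union>i\<in>I. g i) \<inter> A i)) = (\<Prod>i\<in>I. \<phi> i (g i))"
      using inter[OF g] by simp
  qed auto
  finally show ?thesis by simp
qed

text \<open>The exponent is c k + k (k - 1) / 2, so this is the q-binomial theorem divided by the
  q-factorial of \<open>a\<close>, for a product that starts at \<open>q ^ c\<close>. It evaluates
  the sum over the initial segments of one block.\<close>

lemma q_binomial_theorem:
  fixes q s :: "'q::field"
  assumes nz: "\<And>k. k > 0 \<Longrightarrow> q_int q k \<noteq> 0"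
  shows "(\<Sum>k\<le>a. s ^ k * q ^ (\<Sum>b\<in>{c<..c + k}. b - 1) / (q_fact q k * q_fact q (a - k))) =
    (\<Prod>i=c..<c + a. 1 + s * q ^ i) / q_fact q a"
proof (induction a)
  case (Suc a)
  define W where "W k = (\<Sum>b\<in>{c<..c + k}. b - 1)" for k
  have W_Suc: "W (Suc k) = W k + c + k" for k
  proof -
    have "{c<..c + Suc k} = insert (c + Suc k) {c<..c + k}" by auto
    then show ?thesis by (simp add: W_def)
  qed
  define T where "T a k = s ^ k * q ^ W k / (q_fact q k * q_fact q (a - k))" for a k
  have IH: "(\<Sum>k\<le>a. T a k) = (\<Prod>i=c..<c + a. 1 + s * q ^ i) / q_fact q a"
    using Suc by (simp add: T_def W_def)
  \<comment> \<open>The q-Pascal rule: [a + 1] is split as [a + 1 - k] + q^(a + 1 - k) [k]. The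
    first part kills the term \<open>k = Suc a\<close>, the second the term \<open>k = 0\<close>,
    and each lowers one q-factorial.\<close>
  have "q_int q (Suc a) * (\<Sum>k\<le>Suc a. T (Suc a) k) =
      (\<Sum>k\<le>Suc a. q_int q (Suc a - k) * T (Suc a) k) + (\<Sum>k\<le>Suc a. q ^ (Suc a - k) * q_int q k * T (Suc a) k)"
    unfolding sum_distrib_left sum.distrib[symmetric]
  proof (rule sum.cong[OF refl])
    fix k assume "k \<in> {..Suc a}"
    then have "q_int q (Suc a) = q_int q (Suc a - k) + q ^ (Suc a - k) * q_int q k"
      using q_int_add[of q "Suc a - k" k] by simp
    then show "q_int q (Suc a) * T (Suc a) k = q_int q (Suc a - k) * T (Suc a) k + q ^ (Suc a - k) * q_int q k * T (Suc a) k"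
      by (simp add: distrib_right)
  qed
  also have "(\<Sum>k\<le>Suc a. q_int q (Suc a - k) * T (Suc a) k) = (\<Sum>k\<le>a. T a k)"
  proof -
    have "q_int q (Suc a - k) * T (Suc a) k = T a k" if "k \<le> a" for k
      using that nz[of "Suc (a - k)"] by (simp add: T_def Suc_diff_le q_fact_Suc)
    then show ?thesis by simp
  qed
  also have "(\<Sum>k\<le>Suc a. q ^ (Suc a - k) * q_int q k * T (Suc a) k) = s * q ^ (c + a) * (\<Sum>k\<le>a. T a k)"
  proof -
    have "q ^ (a - k) * q_int q (Suc k) * T (Suc a) (Suc k) = s * q ^ (c + a) * T a k" if "k \<le> a" for k
    proof -
      have "q ^ (a - k) * q ^ W (Suc k) = q ^ (c + a) * q ^ W k"
        unfolding W_Suc power_add[symmetric] using that by (intro arg_cong[of _ _ "\<lambda>e. q ^ e"]) simp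
      then show ?thesis
        using nz[of "Suc k"] by (simp add: T_def q_fact_Suc)
    qed
    then show ?thesis
      unfolding sum.atMost_Suc_shift sum_distrib_left by simp
  qed
  finally have "q_int q (Suc a) * (\<Sum>k\<le>Suc a. T (Suc a) k) = (1 + s * q ^ (c + a)) * (\<Sum>k\<le>a. T a k)"
    by (simp add: distrib_right)
  then have "(\<Sum>k\<le>Suc a. T (Suc a) k) = (\<Prod>i=c..<c + Suc a. 1 + s * q ^ i) / q_fact q (Suc a)"
    using nz[of "Suc a"] q_fact_nonzero[OF nz, of a] unfolding IH by (simp add: q_fact_Suc field_simps)
  then show ?case by (simp add: T_def W_def)
qed simp

section \<open>Blocks of values and labels of signed letters\<close>

definition block_label :: "(nat \<Rightarrow> nat) \<Rightarrow> nat \<Rightarrow> nat" where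
  "block_label \<mu> b = (LEAST j. b \<le> \<mu> (Suc j))"

text \<open>Only in block \<open>0\<close> is the sign lost: all its letters have label
  \<open>0\<close>, while a block \<open>j > 0\<close> splits into the labels \<open>j\<close> and
  \<open>- j\<close>.\<close>

definition signed_label :: "(nat \<Rightarrow> nat) \<Rightarrow> int \<Rightarrow> int" where
  "signed_label \<mu> v = sgn v * int (block_label \<mu> (nat \<bar>v\<bar>))"

definition signed_values :: "nat \<Rightarrow> nat set \<Rightarrow> int set" where
  "signed_values n S = (\<lambda>b. if b \<in> S then - int b else int b) ` {1..n}"

lemma finite_signed_values: "finite (signed_values n S)"
  by (simp add: signed_values_def)

lemma inj_signed: "inj_on (\<lambda>b. if b \<in> S then - int b else int b) {1..n}"
  by (auto simp: inj_on_def)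

lemma card_signed_values: "card (signed_values n S) = n"
  unfolding signed_values_def by (subst card_image[OF inj_signed]) simp

text \<open>The first block, \<open>{1..\<mu> 1}\<close>, is the one governed by the type D condition at \<open>0\<close>; there only
  the value \<open>1\<close> may be negated.\<close>

definition block_negations :: "(nat \<Rightarrow> nat) \<Rightarrow> nat \<Rightarrow> nat set set" where
  "block_negations \<mu> j =
    (if j = 0 then Pow ({1} \<inter> {\<mu> 0<..\<mu> 1}) else (\<lambda>k. {\<mu> j<..\<mu> j + k}) ` {..\<mu> (Suc j) - \<mu> j})"

locale block_structure =
  fixes n t :: nat and \<mu> :: "nat \<Rightarrow> nat"
  assumes first: "\<mu> 0 = 0"
    and step: "\<And>j. 1 \<le> j \<Longrightarrow> j \<le> t \<Longrightarrow> \<mu> j < \<mu> (Suc j)"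
    and final: "\<mu> (Suc t) = n"
begin

definition block :: "nat \<Rightarrow> nat set" where
  "block j = {\<mu> j<..\<mu> (Suc j)}"

definition negations :: "nat set set" where
  "negations = {S. S \<subseteq> {1..n} \<and> (\<forall>j\<le>t. S \<inter> block j \<in> block_negations \<mu> j)}"

lemma mu_mono: "i \<le> j \<Longrightarrow> j \<le> Suc t \<Longrightarrow> \<mu> i \<le> \<mu> j"
proof (induction j rule: dec_induct)
  case (step j)
  then have "\<mu> j \<le> \<mu> (Suc j)"
    using block_structure.step[OF block_structure_axioms, of j] first by (cases "j = 0") auto
  with step show ?case by simp
qed simp

lemma block_label_eq:
  assumes "j \<le> t" "b \<in> block j"
  shows "block_label \<mu> b = j"
  unfolding block_label_def
proof (rule Least_equality)
  fix i assume "b \<le> \<mu> (Suc i)"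
  then show "j \<le> i"
    using assms mu_mono[of "Suc i" j] by (force simp: block_def not_less_eq_eq[symmetric])
qed (use assms in \<open>auto simp: block_def\<close>)

lemma block_label_le: "b \<le> n \<Longrightarrow> block_label \<mu> b \<le> t"
  unfolding block_label_def by (rule Least_le) (simp add: final)

lemma le_block_end: "b \<le> n \<Longrightarrow> b \<le> \<mu> (Suc (block_label \<mu> b))"
  unfolding block_label_def by (rule LeastI[of _ t]) (simp add: final)

lemma mem_block_label:
  assumes "b \<in> {1..n}"
  shows "b \<in> block (block_label \<mu> b)"
proof -
  have "b \<le> \<mu> (Suc (block_label \<mu> b))"
    using assms le_block_end by simp
  moreover have "\<mu> (block_label \<mu> b) < b"
  proof (cases "block_label \<mu> b")
    case 0
    then show ?thesis using assms first by simp
  next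
    case (Suc i)
    then have "\<not> b \<le> \<mu> (Suc i)"
      unfolding block_label_def by (metis lessI not_less_Least)
    with Suc show ?thesis by simp
  qed
  ultimately show ?thesis by (simp add: block_def)
qed

lemma block_subset: "j \<le> t \<Longrightarrow> block j \<subseteq> {1..n}"
  using mu_mono[of "Suc j" "Suc t"] final by (auto simp: block_def)

lemma mem_block_iff: "j \<le> t \<Longrightarrow> b \<in> block j \<longleftrightarrow> b \<in> {1..n} \<and> block_label \<mu> b = j"
  using block_label_eq mem_block_label block_subset by blast

lemma block_label_mono: "b \<le> b' \<Longrightarrow> b' \<le> n \<Longrightarrow> block_label \<mu> b \<le> block_label \<mu> b'"
proof -
  assume "b \<le> b'" "b' \<le> n"
  then have "b \<le> \<mu> (Suc (block_label \<mu> b'))"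
    using le_block_end[of b'] by simp
  then show ?thesis
    by (subst block_label_def) (rule Least_le)
qed

text \<open>Among negative letters a later block means a smaller letter and a smaller label. This
  supplies the monotonicity that the theorems on block words require.\<close>

lemma signed_label_mono: "mono_on (signed_values n S) (signed_label \<mu>)"
proof (rule monotone_onI)
  fix x y assume xy: "x \<in> signed_values n S" "y \<in> signed_values n S" "x \<le> y"
  then have range: "nat \<bar>x\<bar> \<le> n" "nat \<bar>y\<bar> \<le> n" by (auto simp: signed_values_def)
  consider "y < 0" | "x \<le> 0" "0 \<le> y" | "0 < x" using xy by linarith
  then show "signed_label \<mu> x \<le> signed_label \<mu> y"
  proof cases
    case 1
    with xy range block_label_mono[of "nat \<bar>y\<bar>" "nat \<bar>x\<bar>"] show ?thesis
      by (auto simp: signed_label_def)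
  next
    case 2
    then show ?thesis by (auto simp: signed_label_def sgn_if)
  next
    case 3
    with xy range block_label_mono[of "nat \<bar>x\<bar>" "nat \<bar>y\<bar>"] show ?thesis
      by (auto simp: signed_label_def)
  qed
qed

lemma signed_label_range: "signed_label \<mu> ` signed_values n S \<subseteq> {- int t..int t}"
  using block_label_le by (force simp: signed_values_def signed_label_def)

text \<open>Block \<open>0\<close> keeps its full size whatever is negated, because the sign does
  not enter its label; every other block is divided by \<open>S\<close> into two fibres.\<close>

lemma card_signed_label_fiber:
  assumes "S \<subseteq> {1..n}"
  shows "card {y \<in> signed_values n S. signed_label \<mu> y = 0} = \<mu> 1"
    and "\<And>j. 1 \<le> j \<Longrightarrow> j \<le> t \<Longrightarrow> card {y \<in> signed_values n S. signed_label \<mu> y = - int j} = card (S \<inter> block j)"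
    and "\<And>j. 1 \<le> j \<Longrightarrow> j \<le> t \<Longrightarrow> card {y \<in> signed_values n S. signed_label \<mu> y = int j} = \<mu> (Suc j) - \<mu> j - card (S \<inter> block j)"
proof -
  let ?g = "\<lambda>b. if b \<in> S then - int b else int b"
  have lab: "signed_label \<mu> (?g b) = (if b \<in> S then - int (block_label \<mu> b) else int (block_label \<mu> b))"
    if "b \<in> {1..n}" for b
    using that by (auto simp: signed_label_def)
  have fiber: "card {y \<in> signed_values n S. signed_label \<mu> y = k} = card {b\<in>{1..n}. signed_label \<mu> (?g b) = k}" for k
  proof -
    have "{y \<in> signed_values n S. signed_label \<mu> y = k} = ?g ` {b\<in>{1..n}. signed_label \<mu> (?g b) = k}"
      by (auto simp: signed_values_def)
    then show ?thesis
      by (metis (no_types, lifting) card_image inj_on_subset inj_signed mem_Collect_eq subsetI)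
  qed
  have lab': "b \<in> {b\<in>{1..n}. signed_label \<mu> (?g b) = k} \<longleftrightarrow>
    b \<in> {1..n} \<and> (if b \<in> S then - int (block_label \<mu> b) else int (block_label \<mu> b)) = k" for b k
    using lab[of b] by (simp only: mem_Collect_eq cong: conj_cong)
  have "{b\<in>{1..n}. signed_label \<mu> (?g b) = 0} = block 0"
    unfolding set_eq_iff lab' using mem_block_iff[of 0] by (auto split: if_splits)
  then show "card {y \<in> signed_values n S. signed_label \<mu> y = 0} = \<mu> 1"
    by (simp add: fiber block_def first)
  fix j assume j: "1 \<le> j" "j \<le> t"
  have "{b\<in>{1..n}. signed_label \<mu> (?g b) = - int j} = S \<inter> block j"
    unfolding set_eq_iff lab' using mem_block_iff[OF j(2)] j by (auto split: if_splits)
  then show "card {y \<in> signed_values n S. signed_label \<mu> y = - int j} = card (S \<inter> block j)"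
    by (simp add: fiber)
  have "{b\<in>{1..n}. signed_label \<mu> (?g b) = int j} = block j - S \<inter> block j"
    unfolding set_eq_iff lab' using mem_block_iff[OF j(2)] j by (auto split: if_splits)
  then show "card {y \<in> signed_values n S. signed_label \<mu> y = int j} = \<mu> (Suc j) - \<mu> j - card (S \<inter> block j)"
    by (simp add: fiber card_Diff_subset block_def)
qed

lemma block_multinomial_signed:
  fixes q :: "'q::field"
  assumes "S \<subseteq> {1..n}"
  shows "block_multinomial q {- int t..int t} (signed_label \<mu>) (signed_values n S) =
    q_fact q n / (q_fact q (\<mu> 1) * (\<Prod>j=1..t. q_fact q (card (S \<inter> block j)) * q_fact q (\<mu> (Suc j) - \<mu> j - card (S \<inter> block j))))"
proof -
  let ?c = "\<lambda>k. q_fact q (card {y \<in> signed_values n S. signed_label \<mu> y = k})"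
  have "{- int t..int t} = insert 0 ((\<lambda>j. - int j) ` {1..t} \<union> int ` {1..t})"
  proof (intro equalityI subsetI)
    fix k assume "k \<in> {- int t..int t}"
    then have "k = 0 \<or> k = - int (nat (- k)) \<and> nat (- k) \<in> {1..t} \<or> k = int (nat k) \<and> nat k \<in> {1..t}"
      by auto
    then show "k \<in> insert 0 ((\<lambda>j. - int j) ` {1..t} \<union> int ` {1..t})" by blast
  qed auto
  then have "(\<Prod>k\<in>{- int t..int t}. ?c k) = ?c 0 * (\<Prod>k\<in>(\<lambda>j. - int j) ` {1..t} \<union> int ` {1..t}. ?c k)"
    by (simp add: image_iff)
  also have "(\<Prod>k\<in>(\<lambda>j. - int j) ` {1..t} \<union> int ` {1..t}. ?c k) =
    (\<Prod>k\<in>(\<lambda>j. - int j) ` {1..t}. ?c k) * (\<Prod>k\<in>int ` {1..t}. ?c k)"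
    by (rule prod.union_disjoint) auto
  also have "\<dots> = (\<Prod>j=1..t. ?c (- int j)) * (\<Prod>j=1..t. ?c (int j))"
    by (subst (1 2) prod.reindex) (auto simp: inj_on_def)
  also have "\<dots> = (\<Prod>j=1..t. q_fact q (card (S \<inter> block j)) * q_fact q (\<mu> (Suc j) - \<mu> j - card (S \<inter> block j)))"
    unfolding prod.distrib[symmetric] using card_signed_label_fiber(2,3)[OF assms]
    by (intro prod.cong) auto
  finally show ?thesis
    by (simp add: block_multinomial_def card_signed_values card_signed_label_fiber(1)[OF assms])
qed

section \<open>Summation over the admissible sets of negated values\<close>

lemma disjoint_blocks: "disjoint_family_on block {..t}"
  using block_label_eq by (auto simp: disjoint_family_on_def)

lemma Union_blocks: "(\<Union>j\<in>{..t}. block j) = {1..n}"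
  using block_subset mem_block_label block_label_le by fastforce

text \<open>An admissible subset of a block \<open>j > 0\<close> is an initial segment, hence
  determined by its size, and the q-binomial theorem applies with
  \<open>c = \<mu> j\<close>.\<close>

lemma sum_block_negations:
  fixes q s :: "'q::field"
  assumes nz: "\<And>k. k > 0 \<Longrightarrow> q_int q k \<noteq> 0" and j: "1 \<le> j" "j \<le> t"
  shows "(\<Sum>T\<in>block_negations \<mu> j. s ^ card T * q ^ (\<Sum>b\<in>T. b - 1) / (q_fact q (card T) * q_fact q (\<mu> (Suc j) - \<mu> j - card T))) =
    (\<Prod>i=\<mu> j..<\<mu> (Suc j). 1 + s * q ^ i) / q_fact q (\<mu> (Suc j) - \<mu> j)"
proof -
  have "inj_on (\<lambda>k. {\<mu> j<..\<mu> j + k}) {..\<mu> (Suc j) - \<mu> j}"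
    by (rule inj_on_inverseI[of _ card]) simp
  then show ?thesis
    using q_binomial_theorem[OF nz, where a = "\<mu> (Suc j) - \<mu> j" and c = "\<mu> j"] j step[OF j]
    by (simp add: block_negations_def sum.reindex)
qed

lemma prod_concat_blocks:
  fixes g :: "nat \<Rightarrow> 'q::comm_monoid_mult"
  shows "(\<Prod>j=1..t. \<Prod>i=\<mu> j..<\<mu> (Suc j). g i) = (\<Prod>i=\<mu> 1..<n. g i)"
proof -
  have "k \<le> t \<Longrightarrow> (\<Prod>j=1..k. \<Prod>i=\<mu> j..<\<mu> (Suc j). g i) = (\<Prod>i=\<mu> 1..<\<mu> (Suc k). g i)" for k
  proof (induction k)
    case (Suc k)
    then show ?case
      using prod.atLeastLessThan_concat[of "\<mu> 1" "\<mu> (Suc k)" "\<mu> (Suc (Suc k))" g] mu_mono[of 1 "Suc k"]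
        mu_mono[of "Suc k" "Suc (Suc k)"] by simp
  qed simp
  from this[of t] show ?thesis by (simp add: final)
qed

text \<open>The weight is multiplicative over blocks, so the sum is a product of block sums: the
  q-binomial theorem for each \<open>j > 0\<close>, and at most the two sets \<open>{}\<close> and
  \<open>{1}\<close> for block \<open>0\<close>.\<close>

theorem sum_negations:
  fixes q s :: "'q::field"
  assumes nz: "\<And>k. k > 0 \<Longrightarrow> q_int q k \<noteq> 0"
  shows "(\<Sum>S\<in>negations. s ^ card S * q ^ (\<Sum>b\<in>S. b - 1) *
      block_multinomial q {- int t..int t} (signed_label \<mu>) (signed_values n S)) =
    q_fact q n / (\<Prod>j\<le>t. q_fact q (\<mu> (Suc j) - \<mu> j)) *
      ((if \<mu> 1 = 0 then 1 else 1 + s) * (\<Prod>i=\<mu> 1..<n. 1 + s * q ^ i))"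
proof -
  \<comment> \<open>The fibre of block \<open>0\<close> always has size \<open>\<mu> 1\<close>, so
    its denominator does not depend on \<open>T\<close>.\<close>
  define \<phi> where "\<phi> j T = s ^ card T * q ^ (\<Sum>b\<in>T. b - 1) /
    (if j = 0 then q_fact q (\<mu> 1) else q_fact q (card T) * q_fact q (\<mu> (Suc j) - \<mu> j - card T))" for j T
  have split0: "{..t} = insert 0 {1..t}" by auto
  have "s ^ card S * q ^ (\<Sum>b\<in>S. b - 1) *
      block_multinomial q {- int t..int t} (signed_label \<mu>) (signed_values n S) =
      q_fact q n * (\<Prod>j\<le>t. \<phi> j (S \<inter> block j))" if S: "S \<in> negations" for S
  proof -
    have S1: "S \<subseteq> {1..n}" using S by (simp add: negations_def)
    then have eq: "S = (\<Union>j\<in>{..t}. S \<inter> block j)" using Union_blocks by blast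
    have dj: "\<forall>i\<in>{..t}. \<forall>j\<in>{..t}. i \<noteq> j \<longrightarrow> (S \<inter> block i) \<inter> (S \<inter> block j) = {}"
      using disjoint_blocks by (auto simp: disjoint_family_on_def)
    have fin: "\<forall>i\<in>{..t}. finite (S \<inter> block i)" by (simp add: block_def)
    have "card S = (\<Sum>j\<le>t. card (S \<inter> block j))"
      by (subst eq, rule card_UN_disjoint) (use fin dj in auto)
    moreover have "(\<Sum>b\<in>S. b - 1) = (\<Sum>j\<le>t. \<Sum>b\<in>S \<inter> block j. b - 1)"
      by (subst eq, rule sum.UNION_disjoint) (use fin dj in auto)
    ultimately show ?thesis
      unfolding block_multinomial_signed[OF S1]
      by (simp add: power_sum \<phi>_def prod_dividef prod.distrib split0 power_add)
  qed
  then have "(\<Sum>S\<in>negations. s ^ card S * q ^ (\<Sum>b\<in>S. b - 1) *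
      block_multinomial q {- int t..int t} (signed_label \<mu>) (signed_values n S)) =
      q_fact q n * (\<Sum>S\<in>negations. \<Prod>j\<le>t. \<phi> j (S \<inter> block j))"
    by (simp add: sum_distrib_left)
  also have "(\<Sum>S\<in>negations. \<Prod>j\<le>t. \<phi> j (S \<inter> block j)) = (\<Prod>j\<le>t. \<Sum>T\<in>block_negations \<mu> j. \<phi> j T)"
  proof -
    have "block_negations \<mu> j \<subseteq> Pow (block j)" if "j \<le> t" for j
      using that mu_mono[of j "Suc j"] by (auto simp: block_negations_def block_def)
    moreover have "finite (block j)" for j
      by (simp add: block_def)
    ultimately show ?thesis
      using sum_prod_restrict_disjoint[OF _ disjoint_blocks, of "block_negations \<mu>" \<phi>]
      by (simp add: negations_def Union_blocks Ball_def)
  qed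
  also have "\<dots> = (\<Sum>T\<in>block_negations \<mu> 0. \<phi> 0 T) * (\<Prod>j=1..t. \<Sum>T\<in>block_negations \<mu> j. \<phi> j T)"
    by (simp add: split0)
  also have "(\<Prod>j=1..t. \<Sum>T\<in>block_negations \<mu> j. \<phi> j T) =
    (\<Prod>j=1..t. (\<Prod>i=\<mu> j..<\<mu> (Suc j). 1 + s * q ^ i) / q_fact q (\<mu> (Suc j) - \<mu> j))"
    using sum_block_negations[OF nz] by (intro prod.cong) (auto simp: \<phi>_def)
  also have "\<dots> = (\<Prod>i=\<mu> 1..<n. 1 + s * q ^ i) / (\<Prod>j=1..t. q_fact q (\<mu> (Suc j) - \<mu> j))"
    unfolding prod_dividef prod_concat_blocks ..
  also have "(\<Sum>T\<in>block_negations \<mu> 0. \<phi> 0 T) = (if \<mu> 1 = 0 then 1 else 1 + s) / q_fact q (\<mu> 1)"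
  proof -
    \<comment> \<open>Negating \<open>1\<close> contributes the factor \<open>s\<close> alone,
      because its exponent \<open>1 - 1\<close> is \<open>0\<close>.\<close>
    have "block_negations \<mu> 0 = (if \<mu> 1 = 0 then {{}} else {{}, {1}})"
      by (auto simp: block_negations_def first)
    then show ?thesis by (simp add: \<phi>_def add_divide_distrib)
  qed
  finally show ?thesis by (simp add: split0 first)
qed

end

section \<open>Windows of signed permutations\<close>

lemma finite_B_group: "finite (B_group n)"
  by (rule finite_subset[OF _ finite_permutations[of "{- int n..int n} - {0}"]]) (auto simp: B_group_def)

lemma B_group_bij: "\<beta> \<in> B_group n \<Longrightarrow> bij \<beta>"
  by (auto simp: B_group_def permutes_bij)

lemma B_group_outside: "\<beta> \<in> B_group n \<Longrightarrow> i \<notin> {- int n..int n} - {0} \<Longrightarrow> \<beta> i = i"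
  using permutes_not_in[of \<beta> "{- int n..int n} - {0}" i] by (simp add: B_group_def)

lemma B_group_odd:
  assumes "\<beta> \<in> B_group n"
  shows "\<beta> (- i) = - \<beta> i"
proof (cases "i \<in> {- int n..int n} - {0}")
  case False
  then have "- i \<notin> {- int n..int n} - {0}" by auto
  with False have "\<beta> (- i) = - i" "\<beta> i = i"
    using B_group_outside[OF assms] by blast+
  then show ?thesis by simp
qed (use assms in \<open>auto simp: B_group_def\<close>)

lemma B_group_range:
  assumes "\<beta> \<in> B_group n"
  shows "\<bar>\<beta> i\<bar> \<in> {1..int n} \<longleftrightarrow> \<bar>i\<bar> \<in> {1..int n}"
proof -
  have "\<beta> i \<in> {- int n..int n} - {0} \<longleftrightarrow> i \<in> {- int n..int n} - {0}"
    using assms by (intro permutes_in_image) (simp add: B_group_def)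
  then show ?thesis by auto
qed

lemma B_group_inv:
  assumes "\<beta> \<in> B_group n"
  shows "inv \<beta> \<in> B_group n"
proof -
  have "inv \<beta> (- x) = - inv \<beta> x" for x
    using B_group_odd[OF assms, of "inv \<beta> x"] B_group_bij[OF assms]
    by (metis bij_inv_eq_iff)
  then show ?thesis
    using assms by (auto simp: B_group_def permutes_inv)
qed

lemma B_group_inv_apply [simp]:
  assumes "\<beta> \<in> B_group n"
  shows "inv \<beta> (\<beta> x) = x" "\<beta> (inv \<beta> x) = x"
  using B_group_bij[OF assms] by (simp_all add: bij_is_inj bij_is_surj surj_f_inv_f)

lemma B_group_eq_iff: "\<beta> \<in> B_group n \<Longrightarrow> \<beta> x = \<beta> y \<longleftrightarrow> x = y"
  using B_group_bij by (metis bij_is_inj inj_eq)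

lemma B_group_abs_eq_iff:
  assumes "\<beta> \<in> B_group n"
  shows "\<bar>\<beta> x\<bar> = \<bar>\<beta> y\<bar> \<longleftrightarrow> \<bar>x\<bar> = \<bar>y\<bar>"
  by (simp add: abs_eq_iff B_group_eq_iff[OF assms] flip: B_group_odd[OF assms])

definition window :: "nat \<Rightarrow> (int \<Rightarrow> int) \<Rightarrow> int list" where
  "window n \<beta> = map (\<lambda>i. \<beta> (int i)) [1..<Suc n]"

text \<open>Values are recorded, not positions: \<open>inv \<beta> (int b) < 0\<close> says that
  \<open>- b\<close> stands in the window. This suits the condition on descents of the inverse,
  which concerns values.\<close>

definition negated :: "nat \<Rightarrow> (int \<Rightarrow> int) \<Rightarrow> nat set" where
  "negated n \<beta> = {b\<in>{1..n}. inv \<beta> (int b) < 0}"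

lemma length_window [simp]: "length (window n \<beta>) = n"
  by (simp add: window_def)

lemma nth_window: "i < n \<Longrightarrow> window n \<beta> ! i = \<beta> (int (Suc i))"
  by (simp add: window_def del: upt_Suc)

lemma mem_signed_values:
  "x \<in> signed_values n S \<longleftrightarrow> \<bar>x\<bar> \<in> {1..int n} \<and> (x < 0 \<longleftrightarrow> nat \<bar>x\<bar> \<in> S)"
proof
  assume R: "\<bar>x\<bar> \<in> {1..int n} \<and> (x < 0 \<longleftrightarrow> nat \<bar>x\<bar> \<in> S)"
  then have "x = (if nat \<bar>x\<bar> \<in> S then - int (nat \<bar>x\<bar>) else int (nat \<bar>x\<bar>))" "nat \<bar>x\<bar> \<in> {1..n}"
    by auto
  then show "x \<in> signed_values n S"
    unfolding signed_values_def by (rule image_eqI)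
qed (auto simp: signed_values_def)

lemma signed_values_eqD:
  assumes "signed_values n S = signed_values n T" "S \<subseteq> {1..n}" "T \<subseteq> {1..n}"
  shows "S = T"
proof -
  have "b \<in> A \<longleftrightarrow> - int b \<in> signed_values n A" if "b \<in> {1..n}" for b A
    using that by (auto simp: mem_signed_values)
  with assms show ?thesis by blast
qed

lemma signed_values_negated:
  assumes "\<beta> \<in> B_group n"
  shows "x \<in> signed_values n (negated n \<beta>) \<longleftrightarrow> \<bar>x\<bar> \<in> {1..int n} \<and> inv \<beta> x > 0"
proof -
  have "inv \<beta> x \<noteq> 0" if "\<bar>x\<bar> \<in> {1..int n}"
    using B_group_range[OF B_group_inv[OF assms], of x] that by auto
  moreover have "inv \<beta> (- x) = - inv \<beta> x"
    using B_group_odd[OF B_group_inv[OF assms]] .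
  ultimately show ?thesis
    by (cases "x < 0") (auto simp: mem_signed_values negated_def)
qed

lemma set_window:
  assumes "\<beta> \<in> B_group n"
  shows "set (window n \<beta>) = signed_values n (negated n \<beta>)"
proof (intro equalityI subsetI)
  fix x assume "x \<in> set (window n \<beta>)"
  then obtain i where "i \<in> {1..n}" "x = \<beta> (int i)"
    by (force simp: window_def simp del: upt_Suc)
  then show "x \<in> signed_values n (negated n \<beta>)"
    using B_group_range[OF assms, of "int i"] assms by (auto simp: signed_values_negated)
next
  fix x assume "x \<in> signed_values n (negated n \<beta>)"
  then have x: "\<bar>x\<bar> \<in> {1..int n}" "inv \<beta> x > 0"
    using signed_values_negated[OF assms] by auto
  then have "inv \<beta> x = int (nat (inv \<beta> x))" "nat (inv \<beta> x) \<in> {1..n}"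
    using B_group_range[OF B_group_inv[OF assms], of x] by auto
  then have "x = \<beta> (int (nat (inv \<beta> x)))" "nat (inv \<beta> x) \<in> set [1..<Suc n]"
    using assms by (auto simp del: upt_Suc)
  then show "x \<in> set (window n \<beta>)"
    unfolding window_def set_map by (rule image_eqI)
qed

lemma distinct_window: "\<beta> \<in> B_group n \<Longrightarrow> distinct (window n \<beta>)"
  by (auto simp: window_def distinct_map inj_on_def B_group_eq_iff simp del: upt_Suc)

lemma inj_on_window: "inj_on (window n) (B_group n)"
proof (rule inj_onI, rule ext)
  fix \<beta> \<beta>' i assume B: "\<beta> \<in> B_group n" "\<beta>' \<in> B_group n" and eq: "window n \<beta> = window n \<beta>'"
  have pos: "\<beta> i = \<beta>' i" if "i \<in> {1..int n}" for i
    using that nth_window[of "nat i - 1" n \<beta>] nth_window[of "nat i - 1" n \<beta>'] eq by auto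
  consider "i \<in> {1..int n}" | "- i \<in> {1..int n}" | "i \<notin> {- int n..int n} - {0}" by force
  then show "\<beta> i = \<beta>' i"
  proof cases
    case 2
    then show ?thesis using pos[of "- i"] B_group_odd[OF B(1), of i] B_group_odd[OF B(2), of i] by simp
  next
    case 3
    then show ?thesis using B B_group_outside by metis
  qed (rule pos)
qed

text \<open>The extension to negative arguments is forced by oddness. It is injective because
  \<open>signed_values n S\<close> holds exactly one of \<open>b\<close> and \<open>- b\<close> for
  each \<open>b\<close> in \<open>{1..n}\<close>.\<close>

lemma window_surj:
  assumes w: "distinct w" "set w = signed_values n S"
  obtains \<beta> where "\<beta> \<in> B_group n" "window n \<beta> = w"
proof
  let ?R = "{- int n..int n} - {0}"
  define \<beta> where "\<beta> i = (if i \<in> ?R then sgn i * w ! (nat \<bar>i\<bar> - 1) else i)" for i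
  have len: "length w = n"
    using w card_signed_values by (metis distinct_card)
  have mem: "w ! k \<in> signed_values n S" if "k < n" for k
    using that w len by (metis nth_mem)
  have abs_inj: "x = y" if "x \<in> signed_values n S" "y \<in> signed_values n S" "\<bar>x\<bar> = \<bar>y\<bar>" for x y
    using that by (auto simp: mem_signed_values abs_if split: if_splits)
  have odd: "\<beta> (- i) = - \<beta> i" if "i \<in> ?R" for i
    using that by (auto simp: \<beta>_def)
  have abs: "\<bar>\<beta> i\<bar> = \<bar>w ! (nat \<bar>i\<bar> - 1)\<bar>" if "i \<in> ?R" for i
    using that by (auto simp: \<beta>_def abs_mult)
  have "inj_on \<beta> ?R"
  proof (rule inj_onI)
    fix i j assume ij: "i \<in> ?R" "j \<in> ?R" "\<beta> i = \<beta> j"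
    have lt: "nat \<bar>i\<bar> - 1 < length w" "nat \<bar>j\<bar> - 1 < length w"
      using ij(1,2) len by auto
    have "\<bar>w ! (nat \<bar>i\<bar> - 1)\<bar> = \<bar>w ! (nat \<bar>j\<bar> - 1)\<bar>"
      using abs[OF ij(1)] abs[OF ij(2)] ij(3) by simp
    then have eq: "w ! (nat \<bar>i\<bar> - 1) = w ! (nat \<bar>j\<bar> - 1)"
      using abs_inj mem lt len by blast
    then have "nat \<bar>i\<bar> - 1 = nat \<bar>j\<bar> - 1"
      using w(1) lt nth_eq_iff_index_eq by blast
    moreover have "nat \<bar>i\<bar> \<ge> 1" "nat \<bar>j\<bar> \<ge> 1" using ij by auto
    ultimately have "nat \<bar>i\<bar> = nat \<bar>j\<bar>" by linarith
    then have "\<bar>i\<bar> = \<bar>j\<bar>" by simp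
    moreover have "w ! (nat \<bar>i\<bar> - 1) \<noteq> 0"
      using mem[of "nat \<bar>i\<bar> - 1"] lt len by (auto simp: mem_signed_values)
    ultimately have "sgn i = sgn j"
      using ij eq by (simp add: \<beta>_def)
    with \<open>\<bar>i\<bar> = \<bar>j\<bar>\<close> show "i = j" by (metis sgn_mult_abs)
  qed
  moreover have "\<beta> ` ?R \<subseteq> ?R"
  proof
    fix x assume "x \<in> \<beta> ` ?R"
    then obtain i where i: "i \<in> ?R" "x = \<beta> i" by blast
    then have "nat \<bar>i\<bar> - 1 < n" by auto
    then have "w ! (nat \<bar>i\<bar> - 1) \<in> signed_values n S" by (rule mem)
    then have "\<bar>x\<bar> \<in> {1..int n}"
      unfolding i(2) abs[OF i(1)] by (simp add: mem_signed_values)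
    then show "x \<in> ?R" by auto
  qed
  ultimately have "bij_betw \<beta> ?R ?R"
    unfolding bij_betw_def by (intro conjI endo_inj_surj) auto
  then have "\<beta> permutes ?R"
    by (intro bij_imp_permutes) (auto simp: \<beta>_def)
  with odd show "\<beta> \<in> B_group n" by (simp add: B_group_def)
  show "window n \<beta> = w"
    by (rule nth_equalityI) (auto simp: len nth_window \<beta>_def nat_add_distrib)
qed

text \<open>\<open>inv \<beta> x\<close> is the position of the letter \<open>x\<close>, so the
  order of letters within a fibre can be read off the inverse.\<close>

lemma sorted_window_iff:
  assumes "\<beta> \<in> B_group n"
  defines "V \<equiv> signed_values n (negated n \<beta>)"
  shows "sorted_wrt (\<lambda>x y. f x = f y \<longrightarrow> x < y) (window n \<beta>) \<longleftrightarrow>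
    (\<forall>x\<in>V. \<forall>y\<in>V. f x = f y \<and> x < y \<longrightarrow> inv \<beta> x < inv \<beta> y)"
proof -
  have V: "V = set (window n \<beta>)" unfolding V_def using set_window[OF assms(1)] by simp
  have idx: "\<exists>i<n. x = \<beta> (int (Suc i)) \<and> inv \<beta> x = int (Suc i)" if x: "x \<in> V" for x
    using x assms(1) nth_window[of _ n \<beta>] unfolding V in_set_conv_nth by (metis B_group_inv_apply(1) length_window)
  have mem: "\<beta> (int (Suc i)) \<in> V" if "i < n" for i
    using that unfolding V by (metis length_window nth_mem nth_window)
  have "sorted_wrt (\<lambda>x y. f x = f y \<longrightarrow> x < y) (window n \<beta>) \<longleftrightarrow>
    (\<forall>i j. i < j \<longrightarrow> j < n \<longrightarrow> f (\<beta> (int (Suc i))) = f (\<beta> (int (Suc j))) \<longrightarrow> \<beta> (int (Suc i)) < \<beta> (int (Suc j)))"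
    by (auto simp: sorted_wrt_iff_nth_less nth_window)
  also have "\<dots> \<longleftrightarrow> (\<forall>x\<in>V. \<forall>y\<in>V. f x = f y \<and> x < y \<longrightarrow> inv \<beta> x < inv \<beta> y)"
  proof (intro iffI allI impI ballI)
    fix x y
    assume L: "\<forall>i j. i < j \<longrightarrow> j < n \<longrightarrow> f (\<beta> (int (Suc i))) = f (\<beta> (int (Suc j))) \<longrightarrow> \<beta> (int (Suc i)) < \<beta> (int (Suc j))"
      and xy: "x \<in> V" "y \<in> V" "f x = f y \<and> x < y"
    obtain i j where ij: "i < n" "x = \<beta> (int (Suc i))" "inv \<beta> x = int (Suc i)"
        "j < n" "y = \<beta> (int (Suc j))" "inv \<beta> y = int (Suc j)"
      using idx xy by meson
    have "\<not> j < i" using L xy(3) ij(1,2,5) by (metis order.asym)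
    moreover have "i \<noteq> j" using xy(3) ij by auto
    ultimately show "inv \<beta> x < inv \<beta> y" using ij by simp
  next
    fix i j
    assume R: "\<forall>x\<in>V. \<forall>y\<in>V. f x = f y \<and> x < y \<longrightarrow> inv \<beta> x < inv \<beta> y"
      and ij: "i < j" "j < n" "f (\<beta> (int (Suc i))) = f (\<beta> (int (Suc j)))"
    have "\<not> \<beta> (int (Suc j)) < \<beta> (int (Suc i))"
    proof
      assume "\<beta> (int (Suc j)) < \<beta> (int (Suc i))"
      with R mem[of i] mem[of j] ij have "inv \<beta> (\<beta> (int (Suc j))) < inv \<beta> (\<beta> (int (Suc i)))" by auto
      with assms ij(1) show False by simp
    qed
    moreover have "\<beta> (int (Suc j)) \<noteq> \<beta> (int (Suc i))"
      using B_group_eq_iff[OF assms(1)] ij(1) by simp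
    ultimately show "\<beta> (int (Suc i)) < \<beta> (int (Suc j))" by simp
  qed
  finally show ?thesis .
qed

section \<open>The statistics in terms of the window and the negated values\<close>

lemma maj_eq_list_maj: "maj n \<beta> = list_maj (window n \<beta>)"
proof -
  have "Des n \<beta> = {i\<in>{1..<length (window n \<beta>)}. window n \<beta> ! (i - 1) > window n \<beta> ! i}"
    by (auto simp: Des_def nth_window add.commute)
  then show ?thesis by (simp add: maj_def list_maj_def)
qed

lemma inversion_number_eq_list_inv: "inversion_number n \<beta> = list_inv (window n \<beta>)"
proof -
  let ?A = "{(i, j). i < j \<and> j < length (window n \<beta>) \<and> window n \<beta> ! i > window n \<beta> ! j}"
  have "{(i, j). 1 \<le> i \<and> i < j \<and> j \<le> n \<and> \<beta> (int i) > \<beta> (int j)} = map_prod Suc Suc ` ?A"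
  proof (intro equalityI subsetI, clarify)
    fix i j :: nat assume "1 \<le> i" "i < j" "j \<le> n" "\<beta> (int i) > \<beta> (int j)"
    then have "(i, j) = map_prod Suc Suc (i - 1, j - 1)" "(i - 1, j - 1) \<in> ?A"
      by (auto simp: nth_window)
    then show "(i, j) \<in> map_prod Suc Suc ` ?A" by (rule image_eqI)
  qed (auto simp: nth_window)
  moreover have "inj_on (map_prod Suc Suc) ?A" by (auto simp: inj_on_def)
  ultimately show ?thesis
    by (simp add: inversion_number_def list_inv_def card_image)
qed

text \<open>Leads from the positions of negative entries, by which \<open>D_group\<close> is
  defined, to the negated values.\<close>

lemma negated_eq_image:
  assumes "\<beta> \<in> B_group n"
  shows "negated n \<beta> = (\<lambda>i. nat (- \<beta> (int i))) ` {i\<in>{1..n}. \<beta> (int i) < 0}"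
proof (intro equalityI subsetI)
  fix b assume b: "b \<in> negated n \<beta>"
  let ?i = "nat (- inv \<beta> (int b))"
  have "\<bar>inv \<beta> (int b)\<bar> \<in> {1..int n}"
    using b B_group_range[OF B_group_inv[OF assms], of "int b"] by (auto simp: negated_def)
  with b have i: "?i \<in> {1..n}" "int ?i = - inv \<beta> (int b)" by (auto simp: negated_def)
  then have "\<beta> (int ?i) = - int b" using assms by (simp add: B_group_odd)
  with i b show "b \<in> (\<lambda>i. nat (- \<beta> (int i))) ` {i\<in>{1..n}. \<beta> (int i) < 0}"
    by (intro image_eqI[of _ _ ?i]) (auto simp: negated_def)
next
  fix b assume "b \<in> (\<lambda>i. nat (- \<beta> (int i))) ` {i\<in>{1..n}. \<beta> (int i) < 0}"
  then obtain i where i: "i \<in> {1..n}" "\<beta> (int i) < 0" "b = nat (- \<beta> (int i))" by auto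
  then have "inv \<beta> (int b) = - int i"
    using assms B_group_odd[OF B_group_inv[OF assms], of "\<beta> (int i)"] by simp
  with i B_group_range[OF assms, of "int i"] show "b \<in> negated n \<beta>"
    by (auto simp: negated_def)
qed

lemma card_negated:
  assumes "\<beta> \<in> B_group n"
  shows "card (negated n \<beta>) = card {i\<in>{1..n}. \<beta> (int i) < 0}"
  unfolding negated_eq_image[OF assms]
  by (rule card_image) (auto simp: inj_on_def B_group_eq_iff[OF assms] dest!: eq_nat_nat_iff[THEN iffD1, rotated 2])

text \<open>A sum of two entries is negative exactly when the entry of greater absolute value
  \<open>b\<close> is negative. Its partner is then any entry of smaller absolute value, which
  leaves \<open>b - 1\<close> choices.\<close>

lemma N2_eq_sum_negated:
  assumes B: "\<beta> \<in> B_group n"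
  shows "N2 n \<beta> = (\<Sum>b\<in>negated n \<beta>. b - 1)"
proof -
  \<comment> \<open>\<open>p b\<close> is the position at which \<open>b\<close> or
    \<open>- b\<close> stands.\<close>
  define p where "p b = nat \<bar>inv \<beta> (int b)\<bar>" for b
  have p_range: "p b \<in> {1..n}" if "b \<in> {1..n}" for b
    using that B_group_range[OF B_group_inv[OF B], of "int b"] by (auto simp: p_def)
  have p_inj: "p a = p b \<longleftrightarrow> a = b" for a b
    using B_group_abs_eq_iff[OF B_group_inv[OF B], of "int a" "int b"] by (auto simp: p_def)
  have abs_p: "\<bar>\<beta> (int (p b))\<bar> = int b" for b
    unfolding p_def using B by (cases "inv \<beta> (int b) < 0") (auto simp: B_group_odd)
  have p_abs: "p (nat \<bar>\<beta> (int i)\<bar>) = i" for i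
    unfolding p_def using B B_group_odd[OF B_group_inv[OF B], of "\<beta> (int i)"]
    by (cases "\<beta> (int i) < 0") auto
  have neg: "\<beta> (int (p b)) = - int b" if "b \<in> negated n \<beta>" for b
    using that B by (auto simp: p_def negated_def B_group_odd)
  have neg': "nat \<bar>\<beta> (int i)\<bar> \<in> negated n \<beta>" if "i \<in> {1..n}" "\<beta> (int i) < 0" for i
    using that unfolding negated_eq_image[OF B] by (auto simp: image_iff)
  let ?P = "SIGMA b:negated n \<beta>. {1..<b}"
  let ?h = "\<lambda>(b, a). {p a, p b}"
  have inP: "{i, j} \<in> ?h ` ?P"
    if "i \<in> {1..n}" "j \<in> {1..n}" "\<bar>\<beta> (int i)\<bar> < \<bar>\<beta> (int j)\<bar>" "\<beta> (int i) + \<beta> (int j) < 0" for i j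
  proof -
    have "\<beta> (int j) < 0" using that by linarith
    then have "(nat \<bar>\<beta> (int j)\<bar>, nat \<bar>\<beta> (int i)\<bar>) \<in> ?P"
      using that neg'[of j] B_group_range[OF B, of "int i"] by auto
    moreover have "{i, j} = ?h (nat \<bar>\<beta> (int j)\<bar>, nat \<bar>\<beta> (int i)\<bar>)" by (simp add: p_abs)
    ultimately show ?thesis by (metis (no_types, lifting) image_eqI)
  qed
  have "{{i, j} |i j. i \<in> {1..n} \<and> j \<in> {1..n} \<and> i \<noteq> j \<and> \<beta> (int i) + \<beta> (int j) < 0} = ?h ` ?P"
  proof (intro equalityI subsetI)
    fix X assume "X \<in> {{i, j} |i j. i \<in> {1..n} \<and> j \<in> {1..n} \<and> i \<noteq> j \<and> \<beta> (int i) + \<beta> (int j) < 0}"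
    then obtain i j where ij: "X = {i, j}" "i \<in> {1..n}" "j \<in> {1..n}" "i \<noteq> j" "\<beta> (int i) + \<beta> (int j) < 0" by auto
    then have "\<bar>\<beta> (int i)\<bar> \<noteq> \<bar>\<beta> (int j)\<bar>" using B_group_abs_eq_iff[OF B] by simp
    then show "X \<in> ?h ` ?P"
      using inP[of i j] inP[of j i] ij by (metis add.commute insert_commute linorder_neqE)
  next
    fix X assume "X \<in> ?h ` ?P"
    then obtain a b where ab: "b \<in> negated n \<beta>" "a \<in> {1..<b}" "X = {p a, p b}" by auto
    then have "b \<in> {1..n}" "a \<in> {1..n}" by (auto simp: negated_def)
    moreover have "\<beta> (int (p a)) + \<beta> (int (p b)) < 0"
      using ab neg[of b] abs_p[of a] by auto
    moreover have "p a \<noteq> p b" using ab by (auto simp: p_inj)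
    ultimately show "X \<in> {{i, j} |i j. i \<in> {1..n} \<and> j \<in> {1..n} \<and> i \<noteq> j \<and> \<beta> (int i) + \<beta> (int j) < 0}"
      using ab p_range by blast
  qed
  moreover have "inj_on ?h ?P"
    by (auto simp: inj_on_def doubleton_eq_iff p_inj)
  ultimately have "N2 n \<beta> = card ?P"
    by (simp add: N2_def card_image)
  also have "\<dots> = (\<Sum>b\<in>negated n \<beta>. b - 1)"
    by (subst card_SigmaI) (auto simp: negated_def)
  finally show ?thesis .
qed

section \<open>Descents of the inverse\<close>

text \<open>Brings the negated values of a block into the form used by
  \<open>block_negations\<close>.\<close>

lemma downward_closed_interval:
  fixes c d :: nat
  assumes "T \<subseteq> {c<..d}" "\<And>u v. u \<in> {c<..d} \<Longrightarrow> v \<in> T \<Longrightarrow> u < v \<Longrightarrow> u \<in> T"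
  shows "T \<in> (\<lambda>k. {c<..c + k}) ` {..d - c}"
proof (cases "T = {}")
  case False
  have "finite T" using assms(1) finite_subset by blast
  then have max: "Max T \<in> T" "\<And>u. u \<in> T \<Longrightarrow> u \<le> Max T" using False by auto
  have "T = {c<..Max T}"
  proof (intro equalityI subsetI)
    fix u assume "u \<in> {c<..Max T}"
    moreover have "Max T \<le> d" using max(1) assms(1) by auto
    ultimately show "u \<in> T"
      using assms(2)[of u "Max T"] max(1) by (cases "u = Max T") auto
  qed (use assms(1) max in auto)
  moreover have "c < Max T" "Max T \<le> d" using max(1) assms(1) by auto
  ultimately show ?thesis
    by (intro image_eqI[of _ _ "Max T - c"]) auto
qed (auto intro!: image_eqI[of _ _ 0])

context block_structure
begin

text \<open>To be applied to \<open>p = inv \<beta>\<close>. The second clause excludes the descent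
  at \<open>0\<close>, that is \<open>- p 2 > p 1\<close>; it is imposed when the first block is
  nonempty, since then \<open>0\<close> is not a boundary.\<close>

definition increasing_on_blocks :: "(int \<Rightarrow> int) \<Rightarrow> bool" where
  "increasing_on_blocks p \<longleftrightarrow> (\<forall>j\<le>t. \<forall>u\<in>block j. \<forall>v\<in>block j. u < v \<longrightarrow> p (int u) < p (int v)) \<and>
    (\<mu> 1 \<noteq> 0 \<longrightarrow> p 1 + p 2 > 0)"

lemma not_boundary_iff:
  assumes "1 \<le> i" "i < n"
  shows "i \<notin> \<mu> ` {1..t} \<longleftrightarrow> Suc i \<in> block (block_label \<mu> i)"
proof -
  define j where "j = block_label \<mu> i"
  have j: "j \<le> t" "i \<in> block j"
    using assms block_label_le[of i] mem_block_label[of i] by (auto simp: j_def)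
  have "Suc i \<in> block j" if "i \<notin> \<mu> ` {1..t}"
  proof -
    have "i \<noteq> \<mu> (Suc j)"
    proof (cases "j = t")
      case True then show ?thesis using final assms by simp
    next
      case False
      then have "Suc j \<in> {1..t}" using j(1) by simp
      then show ?thesis using that by blast
    qed
    then show ?thesis using j(2) by (auto simp: block_def)
  qed
  moreover have False if "k \<in> {1..t}" "i = \<mu> k" "Suc i \<in> block j" for k
  proof (cases "k \<le> j")
    case True
    then show False using that j mu_mono[of k j] by (auto simp: block_def)
  next
    case False
    then show False using that j mu_mono[of "Suc j" k] by (auto simp: block_def)
  qed
  ultimately show ?thesis unfolding j_def[symmetric] by blast
qed

text \<open>A forbidden descent at \<open>i > 0\<close> compares two consecutive values of one
  block, and transitivity extends the comparison to any two values of the block.\<close>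

lemma Des_D_subset_iff:
  assumes "p \<in> B_group n" "n \<ge> 2"
  shows "Des_D n p \<subseteq> \<mu> ` {1..t} \<longleftrightarrow> increasing_on_blocks p"
proof -
  let ?M = "\<mu> ` {1..t}"
  have zero: "0 \<in> ?M \<longleftrightarrow> \<mu> 1 = 0"
  proof
    assume "0 \<in> ?M"
    then obtain k where "k \<in> {1..t}" "\<mu> k = 0" by auto
    then show "\<mu> 1 = 0" using mu_mono[of 1 k] by simp
  next
    assume *: "\<mu> 1 = 0"
    then have "t \<noteq> 0" using final assms(2) by (intro notI) simp
    then have "1 \<in> {1..t}" by simp
    with * show "0 \<in> ?M" by (metis image_eqI)
  qed
  have des0: "0 \<in> Des_D n p \<longleftrightarrow> p 1 + p 2 < 0"
    by (auto simp: Des_D_def)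
  \<comment> \<open>\<open>p 1\<close> and \<open>p 2\<close> differ in absolute value, so the
    absence of a descent at \<open>0\<close> is a strict inequality.\<close>
  have ne0: "p 1 + p 2 \<noteq> 0"
    using B_group_abs_eq_iff[OF assms(1), of 1 2] by auto
  have des: "i \<in> Des_D n p \<longleftrightarrow> \<not> p (int i) < p (int (Suc i))" if "1 \<le> i" "i < n" for i
    using that B_group_eq_iff[OF assms(1), of "int i" "int (Suc i)"] by (auto simp: Des_D_def add.commute)
  have chain: "p (int u) < p (int v)" if "Des_D n p \<subseteq> ?M" "j \<le> t" "u \<in> block j" "v \<in> block j" "u < v" for j u v
    using \<open>u < v\<close> \<open>v \<in> block j\<close>
  proof (induction v)
    case (Suc v)
    then have v: "v \<in> block j" using \<open>u \<in> block j\<close> by (auto simp: block_def)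
    have range: "1 \<le> v" "v < n"
      using v Suc.prems(2) block_subset[OF \<open>j \<le> t\<close>] by auto
    have "v \<notin> ?M"
      using not_boundary_iff[OF range] v Suc.prems(2) block_label_eq[OF \<open>j \<le> t\<close>] by simp
    then have "p (int v) < p (int (Suc v))"
      using des[OF range] that(1) by blast
    then show ?case
      using Suc v by (cases "u = v") auto
  qed simp
  show ?thesis
  proof
    assume L: "Des_D n p \<subseteq> ?M"
    then show "increasing_on_blocks p"
      using chain[OF L] zero des0 ne0 by (auto simp: increasing_on_blocks_def)
  next
    assume R: "increasing_on_blocks p"
    show "Des_D n p \<subseteq> ?M"
    proof
      fix i assume i: "i \<in> Des_D n p"
      show "i \<in> ?M"
      proof (cases "i = 0")
        case True
        then show ?thesis using i R zero des0 by (auto simp: increasing_on_blocks_def)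
      next
        case False
        then have range: "1 \<le> i" "i < n" using i assms(2) by (auto simp: Des_D_def)
        show ?thesis
        proof (rule ccontr)
          assume "i \<notin> ?M"
          then have "Suc i \<in> block (block_label \<mu> i)"
            using not_boundary_iff[OF range] by simp
          moreover have "i \<in> block (block_label \<mu> i)" "block_label \<mu> i \<le> t"
            using range mem_block_label[of i] block_label_le[of i] by auto
          ultimately have "p (int i) < p (int (Suc i))"
            using R unfolding increasing_on_blocks_def by blast
          with des[OF range] i show False by simp
        qed
      qed
    qed
  qed
qed

text \<open>In the first block \<open>-1\<close> and the positive values share a label: the condition at \<open>0\<close> makes
  \<open>-1\<close> precede \<open>2\<close> exactly as the condition at \<open>1\<close> makes \<open>1\<close> precede \<open>2\<close>.\<close>

lemma increasing_on_blocks_iff: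
  assumes B: "\<beta> \<in> B_group n" and "\<mu> 1 \<noteq> 1"
  defines "V \<equiv> signed_values n (negated n \<beta>)"
  shows "increasing_on_blocks (inv \<beta>) \<longleftrightarrow> negated n \<beta> \<in> negations \<and>
    (\<forall>x\<in>V. \<forall>y\<in>V. signed_label \<mu> x = signed_label \<mu> y \<and> x < y \<longrightarrow> inv \<beta> x < inv \<beta> y)"
proof
  define p where "p = inv \<beta>"
  have V: "x \<in> V \<longleftrightarrow> \<bar>x\<bar> \<in> {1..int n} \<and> p x > 0" for x
    unfolding V_def p_def by (rule signed_values_negated[OF B])
  have odd: "p (- x) = - p x" for x
    unfolding p_def by (rule B_group_odd[OF B_group_inv[OF B]])
  have nonzero: "p x \<noteq> 0" if "\<bar>x\<bar> \<in> {1..int n}" for x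
    using B_group_range[OF B_group_inv[OF B], of x] that by (auto simp: p_def)
  have neg: "b \<in> negated n \<beta> \<longleftrightarrow> b \<in> {1..n} \<and> p (int b) < 0" for b
    by (simp add: negated_def p_def)
  have lab: "\<bar>signed_label \<mu> x\<bar> = int (block_label \<mu> (nat \<bar>x\<bar>))" if "x \<in> V" for x
    using that by (auto simp: V signed_label_def abs_mult abs_sgn_eq)
  have block_abs: "nat \<bar>x\<bar> \<in> block (block_label \<mu> (nat \<bar>x\<bar>))" "block_label \<mu> (nat \<bar>x\<bar>) \<le> t" if "x \<in> V" for x
    using that by (auto simp: V intro!: mem_block_label block_label_le)
  {
    assume "increasing_on_blocks (inv \<beta>)"
    then have inc: "\<And>j u v. j \<le> t \<Longrightarrow> u \<in> block j \<Longrightarrow> v \<in> block j \<Longrightarrow> u < v \<Longrightarrow> p (int u) < p (int v)"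
      and zero: "\<mu> 1 \<noteq> 0 \<Longrightarrow> p 1 + p 2 > 0"
      unfolding increasing_on_blocks_def p_def by blast+
    \<comment> \<open>From \<open>p 1 < p 2\<close> and \<open>p 1 + p 2 > 0\<close> it follows that
      \<open>p 2\<close> exceeds both \<open>p 1\<close> and \<open>- p 1\<close> and is positive,
      and \<open>p\<close> grows further along the block. Hence only \<open>1\<close> can be negated
      here.\<close>
    have first_block: "p (int v) > 0 \<and> - p 1 < p (int v)" if "v \<in> block 0" "v \<ge> 2" for v
    proof -
      have 12: "1 \<in> block 0" "2 \<in> block 0" using that by (auto simp: block_def first)
      then have "p 1 + p 2 > 0" using zero by (auto simp: block_def)
      moreover have "p 1 < p 2" using inc[OF _ 12] by simp
      moreover have "p 2 \<le> p (int v)" using inc[OF _ 12(2) that(1)] that by (cases "v = 2") auto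
      ultimately show ?thesis by linarith
    qed
    have "negated n \<beta> \<inter> block j \<in> block_negations \<mu> j" if "j \<le> t" for j
    proof (cases "j = 0")
      case True
      have "b = 1" if "b \<in> negated n \<beta>" "b \<in> block 0" for b
      proof (rule ccontr)
        assume "b \<noteq> 1"
        then have "b \<ge> 2" using that(2) by (simp add: block_def first)
        then show False using first_block[of b] that neg by auto
      qed
      then show ?thesis using True by (auto simp: block_negations_def block_def)
    next
      case False
      \<comment> \<open>The inverse increases on the block, so it is negative on an initial
        segment.\<close>
      have "negated n \<beta> \<inter> block j \<in> (\<lambda>k. {\<mu> j<..\<mu> j + k}) ` {..\<mu> (Suc j) - \<mu> j}"
      proof (rule downward_closed_interval)
        fix u v assume uv: "u \<in> {\<mu> j<..\<mu> (Suc j)}" "v \<in> negated n \<beta> \<inter> block j" "u < v"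
        then have "u \<in> block j" by (simp add: block_def)
        with uv inc[OF \<open>j \<le> t\<close>, of u v] show "u \<in> negated n \<beta> \<inter> block j"
          using block_subset[OF \<open>j \<le> t\<close>] by (auto simp: neg)
      qed (auto simp: block_def)
      with False show ?thesis by (simp add: block_negations_def)
    qed
    then have "negated n \<beta> \<in> negations"
      by (auto simp: negations_def negated_def)
    moreover have "p x < p y" if xy: "x \<in> V" "y \<in> V" "signed_label \<mu> x = signed_label \<mu> y" "x < y" for x y
    proof -
      define j where "j = block_label \<mu> (nat \<bar>x\<bar>)"
      have j: "j \<le> t" "nat \<bar>x\<bar> \<in> block j" "nat \<bar>y\<bar> \<in> block j"
        using block_abs[OF xy(1)] block_abs[OF xy(2)] lab[OF xy(1)] lab[OF xy(2)] xy(3) by (auto simp: j_def)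
      consider "0 < x" | "y < 0" | "x < 0" "0 < y" using xy(4) V[of x] V[of y] xy(1,2) by fastforce
      then show ?thesis
      proof cases
        case 1
        then show ?thesis using inc[OF j] xy(4) by simp
      next
        case 2
        then have "p (- y) < p (- x)" using inc[OF j(1,3,2)] xy(4) by simp
        then show ?thesis by (simp add: odd)
      next
        case 3
        \<comment> \<open>Letters of opposite sign share a label only if it is \<open>0\<close>; in
          the first block the negative one must be \<open>- 1\<close>.\<close>
        then have "j = 0"
          using xy(3) j(1) block_label_eq[OF j(1,2)] block_label_eq[OF j(1,3)] by (auto simp: signed_label_def)
        have "x = - 1"
        proof (rule ccontr)
          assume "x \<noteq> - 1"
          then have "p (- x) > 0" using first_block[of "nat \<bar>x\<bar>"] j \<open>j = 0\<close> 3 by auto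
          then show False using xy(1) by (simp add: V odd)
        qed
        moreover have "y \<noteq> 1"
          using xy(1,2) \<open>x = - 1\<close> odd[of 1] by (auto simp: V)
        ultimately show ?thesis
          using first_block[of "nat \<bar>y\<bar>"] j \<open>j = 0\<close> 3 odd[of 1] by auto
      qed
    qed
    ultimately show "negated n \<beta> \<in> negations \<and>
      (\<forall>x\<in>V. \<forall>y\<in>V. signed_label \<mu> x = signed_label \<mu> y \<and> x < y \<longrightarrow> inv \<beta> x < inv \<beta> y)"
      unfolding p_def by blast
  next
    assume R: "negated n \<beta> \<in> negations \<and>
      (\<forall>x\<in>V. \<forall>y\<in>V. signed_label \<mu> x = signed_label \<mu> y \<and> x < y \<longrightarrow> inv \<beta> x < inv \<beta> y)"
    then have N: "\<And>j. j \<le> t \<Longrightarrow> negated n \<beta> \<inter> block j \<in> block_negations \<mu> j"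
      and inc: "\<And>x y. x \<in> V \<Longrightarrow> y \<in> V \<Longrightarrow> signed_label \<mu> x = signed_label \<mu> y \<Longrightarrow> x < y \<Longrightarrow> p x < p y"
      by (auto simp: negations_def p_def)
    have N0: "b = 1" if "b \<in> block 0" "p (int b) < 0" for b
    proof -
      have "b \<in> negated n \<beta> \<inter> block 0" using that block_subset[of 0] by (auto simp: neg)
      then show ?thesis using N[of 0] by (auto simp: block_negations_def)
    qed
    \<comment> \<open>In a block \<open>j > 0\<close> the negated values form an initial segment,
      which excludes a positive \<open>p (int u)\<close> followed by a negative
      \<open>p (int v)\<close>.\<close>
    have down: "p (int u) < 0" if j: "j \<le> t" "j \<noteq> 0" and uv: "u \<in> block j" "v \<in> block j" "u < v" "p (int v) < 0" for j u v
    proof -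
      obtain k where k: "negated n \<beta> \<inter> block j = {\<mu> j<..\<mu> j + k}"
        using N[OF j(1)] j(2) by (auto simp: block_negations_def)
      have "v \<in> negated n \<beta> \<inter> block j" using uv block_subset[OF j(1)] by (auto simp: neg)
      then have "u \<in> negated n \<beta> \<inter> block j" using uv(1,3) unfolding k by (auto simp: block_def)
      then show ?thesis by (simp add: neg)
    qed
    have "p (int u) < p (int v)" if uv: "j \<le> t" "u \<in> block j" "v \<in> block j" "u < v" for j u v
    proof -
      have range: "\<bar>int u\<bar> \<in> {1..int n}" "\<bar>int v\<bar> \<in> {1..int n}"
        using block_subset[OF uv(1)] uv(2,3) by auto
      have label: "block_label \<mu> u = j" "block_label \<mu> v = j"
        using block_label_eq uv by auto
      consider "p (int u) < 0" "p (int v) > 0" | "p (int u) > 0" "p (int v) > 0"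
        | "p (int u) < 0" "p (int v) < 0" | "p (int u) > 0" "p (int v) < 0"
        using nonzero[OF range(1)] nonzero[OF range(2)] by linarith
      then show ?thesis
      proof cases
        case 2
        then show ?thesis using inc[of "int u" "int v"] range label uv(4)
          by (auto simp: V signed_label_def)
      next
        case 3
        then have "p (- int v) < p (- int u)" using inc[of "- int v" "- int u"] range label uv(4)
          by (auto simp: V odd signed_label_def)
        then show ?thesis by (simp add: odd)
      next
        case 4
        then have "j = 0" using down[OF uv(1) _ uv(2,3,4)] by auto
        with 4 uv N0[of v] have "v = 1" by simp
        then show ?thesis using uv(4) range by simp
      qed simp
    qed
    moreover have "p 1 + p 2 > 0" if "\<mu> 1 \<noteq> 0"
    proof -
      \<comment> \<open>A nonempty first block contains both \<open>1\<close> and \<open>2\<close>,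
        because \<open>\<mu> 1 \<noteq> 1\<close>.\<close>
      have 12: "1 \<in> block 0" "2 \<in> block 0" using that assms(2) by (auto simp: block_def first)
      then have n: "2 \<le> n" using block_subset[of 0] by auto
      have "p 2 > 0" using N0[of 2] 12 nonzero[of 2] n by force
      show ?thesis
      proof (cases "p 1 > 0")
        \<comment> \<open>If \<open>1\<close> is negated, then \<open>- 1\<close> and
          \<open>2\<close> are letters with the same label, and their order is exactly the condition
          at \<open>0\<close>.\<close>
        case False
        then have "- 1 \<in> V" "2 \<in> V" using nonzero[of 1] n \<open>p 2 > 0\<close> odd[of 1] by (auto simp: V)
        moreover have "signed_label \<mu> (- 1) = signed_label \<mu> 2"
          using block_label_eq[OF _ 12(1)] block_label_eq[OF _ 12(2)] by (simp add: signed_label_def)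
        ultimately have "p (- 1) < p 2" using inc by simp
        then show ?thesis using odd[of 1] by simp
      qed (use \<open>p 2 > 0\<close> in simp)
    qed
    ultimately show "increasing_on_blocks (inv \<beta>)"
      unfolding increasing_on_blocks_def p_def by blast
  }
qed

text \<open>For an admissible \<open>S\<close>, all that remains of the descent condition is that
  letters with equal label occur in increasing order.\<close>

lemma bij_betw_window:
  assumes "n \<ge> 2" "\<mu> 1 \<noteq> 1" "S \<in> negations"
  shows "bij_betw (window n) {\<beta>\<in>B_group n. Des_D n (inv \<beta>) \<subseteq> \<mu> ` {1..t} \<and> negated n \<beta> = S}
    (block_words (signed_label \<mu>) (signed_values n S))"
  unfolding bij_betw_def
proof (intro conjI equalityI subsetI)
  show "inj_on (window n) {\<beta>\<in>B_group n. Des_D n (inv \<beta>) \<subseteq> \<mu> ` {1..t} \<and> negated n \<beta> = S}"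
    by (rule inj_on_subset[OF inj_on_window]) auto
next
  fix w assume "w \<in> window n ` {\<beta>\<in>B_group n. Des_D n (inv \<beta>) \<subseteq> \<mu> ` {1..t} \<and> negated n \<beta> = S}"
  then obtain \<beta> where \<beta>: "w = window n \<beta>" "\<beta> \<in> B_group n" "Des_D n (inv \<beta>) \<subseteq> \<mu> ` {1..t}" "negated n \<beta> = S"
    by auto
  then show "w \<in> block_words (signed_label \<mu>) (signed_values n S)"
    using Des_D_subset_iff[OF B_group_inv[OF \<beta>(2)] assms(1)] increasing_on_blocks_iff[OF \<beta>(2) assms(2)]
      sorted_window_iff[OF \<beta>(2), of "signed_label \<mu>"] set_window distinct_window
    unfolding block_words_def by blast
next
  fix w assume w: "w \<in> block_words (signed_label \<mu>) (signed_values n S)"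
  then obtain \<beta> where \<beta>: "\<beta> \<in> B_group n" "window n \<beta> = w"
    using window_surj[of w n S] by (auto simp: block_words_def)
  have "signed_values n (negated n \<beta>) = signed_values n S"
    using set_window[OF \<beta>(1)] \<beta>(2) w by (simp add: block_words_def)
  then have "negated n \<beta> = S"
    by (rule signed_values_eqD) (use assms(3) in \<open>auto simp: negated_def negations_def\<close>)
  moreover have "sorted_wrt (\<lambda>x y. signed_label \<mu> x = signed_label \<mu> y \<longrightarrow> x < y) (window n \<beta>)"
    using w \<beta>(2) by (simp add: block_words_def)
  ultimately have "Des_D n (inv \<beta>) \<subseteq> \<mu> ` {1..t}"
    using Des_D_subset_iff[OF B_group_inv[OF \<beta>(1)] assms(1)] increasing_on_blocks_iff[OF \<beta>(1) assms(2)]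
      sorted_window_iff[OF \<beta>(1), of "signed_label \<mu>"] assms(3) by blast
  with \<beta> \<open>negated n \<beta> = S\<close> show "w \<in> window n ` {\<beta>\<in>B_group n. Des_D n (inv \<beta>) \<subseteq> \<mu> ` {1..t} \<and> negated n \<beta> = S}"
    by blast
qed

lemma finite_negations: "finite negations"
  by (rule finite_subset[of _ "Pow {1..n}"]) (auto simp: negations_def)

text \<open>The signed permutations are grouped by their negated values. \<open>N2\<close> is
  constant on each group, so only \<open>g\<close>, which will be maj or inv of the window, varies;
  \<open>P\<close> will select a parity.\<close>

lemma sum_B_group_eq_sum_negations:
  fixes q :: "'q::field" and g :: "int list \<Rightarrow> nat"
  assumes "n \<ge> 2" "\<mu> 1 \<noteq> 1"
    and words: "\<And>S. (\<Sum>w\<in>block_words (signed_label \<mu>) (signed_values n S). q ^ g w) = h S"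
  shows "(\<Sum>\<beta> | \<beta> \<in> B_group n \<and> Des_D n (inv \<beta>) \<subseteq> \<mu> ` {1..t} \<and> P (negated n \<beta>). q ^ (g (window n \<beta>) + N2 n \<beta>)) =
    (\<Sum>S | S \<in> negations \<and> P S. q ^ (\<Sum>b\<in>S. b - 1) * h S)"
proof -
  let ?X = "{\<beta>. \<beta> \<in> B_group n \<and> Des_D n (inv \<beta>) \<subseteq> \<mu> ` {1..t} \<and> P (negated n \<beta>)}"
  let ?T = "{S. S \<in> negations \<and> P S}"
  have img: "negated n ` ?X \<subseteq> ?T"
    using Des_D_subset_iff[OF B_group_inv assms(1)] increasing_on_blocks_iff[OF _ assms(2)] by auto
  have "(\<Sum>\<beta>\<in>?X. q ^ (g (window n \<beta>) + N2 n \<beta>)) =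
    (\<Sum>S\<in>?T. \<Sum>\<beta>\<in>{\<beta>\<in>?X. negated n \<beta> = S}. q ^ (g (window n \<beta>) + N2 n \<beta>))"
    using finite_B_group finite_negations img by (intro sum.group[symmetric]) auto
  also have "\<dots> = (\<Sum>S\<in>?T. q ^ (\<Sum>b\<in>S. b - 1) * h S)"
  proof (rule sum.cong[OF refl])
    fix S assume S: "S \<in> ?T"
    let ?Y = "{\<beta>\<in>B_group n. Des_D n (inv \<beta>) \<subseteq> \<mu> ` {1..t} \<and> negated n \<beta> = S}"
    have "{\<beta>\<in>?X. negated n \<beta> = S} = ?Y" using S by auto
    then have "(\<Sum>\<beta>\<in>{\<beta>\<in>?X. negated n \<beta> = S}. q ^ (g (window n \<beta>) + N2 n \<beta>)) =
      (\<Sum>\<beta>\<in>?Y. q ^ (\<Sum>b\<in>S. b - 1) * q ^ g (window n \<beta>))"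
      by (intro sum.cong) (auto simp: N2_eq_sum_negated power_add)
    also have "\<dots> = q ^ (\<Sum>b\<in>S. b - 1) * (\<Sum>w\<in>block_words (signed_label \<mu>) (signed_values n S). q ^ g w)"
      using S by (subst sum.reindex_bij_betw[OF bij_betw_window[OF assms(1,2)], symmetric])
        (auto simp: sum_distrib_left)
    finally show "(\<Sum>\<beta>\<in>{\<beta>\<in>?X. negated n \<beta> = S}. q ^ (g (window n \<beta>) + N2 n \<beta>)) = q ^ (\<Sum>b\<in>S. b - 1) * h S"
      by (simp add: words)
  qed
  finally show ?thesis .
qed

text \<open>The generating function by number of negations \<open>s\<close> vanishes at \<open>s = -1\<close>, so each parity class
  contributes one half.\<close>

lemma sum_negations_parity:
  fixes q :: "'q::field"
  assumes nz: "\<And>k. k > 0 \<Longrightarrow> q_int q k \<noteq> 0" and two: "(2::'q) \<noteq> 0" and "n \<ge> 2"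
  shows "(\<Sum>S | S \<in> negations \<and> (even (card S) \<longleftrightarrow> e). q ^ (\<Sum>b\<in>S. b - 1) *
      block_multinomial q {- int t..int t} (signed_label \<mu>) (signed_values n S)) =
    q_fact q n / (\<Prod>j\<le>t. q_fact q (\<mu> (Suc j) - \<mu> j)) * (\<Prod>i=max 1 (\<mu> 1)..<n. 1 + q ^ i)"
proof -
  define G where "G S = q ^ (\<Sum>b\<in>S. b - 1) *
      block_multinomial q {- int t..int t} (signed_label \<mu>) (signed_values n S)" for S
  define C where "C = q_fact q n / (\<Prod>j\<le>t. q_fact q (\<mu> (Suc j) - \<mu> j))"
  have plus: "(\<Sum>S\<in>negations. G S) = 2 * (C * (\<Prod>i=max 1 (\<mu> 1)..<n. 1 + q ^ i))"
  proof -
    have "(\<Sum>S\<in>negations. G S) = C * ((if \<mu> 1 = 0 then 1 else 2) * (\<Prod>i=\<mu> 1..<n. 1 + q ^ i))"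
      using sum_negations[OF nz, of 1] by (simp add: G_def C_def)
    \<comment> \<open>If \<open>\<mu> 1 = 0\<close>, the 2 is the factor for \<open>i = 0\<close> of
      the product; otherwise it is \<open>1 + s\<close> at \<open>s = 1\<close>. The lower bound
      \<open>max 1 (\<mu> 1)\<close> covers both.\<close>
    also have "\<dots> = 2 * (C * (\<Prod>i=max 1 (\<mu> 1)..<n. 1 + q ^ i))"
      using assms(3) by (cases "\<mu> 1 = 0") (auto simp: prod.atLeast_Suc_lessThan[of 0 n] max_def)
    finally show ?thesis .
  qed
  have minus: "(\<Sum>S\<in>negations. (- 1) ^ card S * G S) = 0"
  proof -
    \<comment> \<open>The vanishing factor is \<open>1 + s\<close> if the first block is nonempty,
      and the one for \<open>i = 0\<close> if it is empty.\<close>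
    have "(if \<mu> 1 = 0 then 1 else 1 + (- 1)) * (\<Prod>i=\<mu> 1..<n. 1 + (- 1) * q ^ i) = 0"
      using assms(3) by (cases "\<mu> 1 = 0") (auto intro!: bexI[of _ 0])
    then show ?thesis
      using sum_negations[OF nz, of "- 1"] by (simp add: G_def mult.assoc)
  qed
  \<comment> \<open>Half of \<open>1 + (- 1) ^ card S\<close> or of
    \<open>1 - (- 1) ^ card S\<close> is the indicator of a parity.\<close>
  have "2 * (\<Sum>S | S \<in> negations \<and> (even (card S) \<longleftrightarrow> e). G S) =
      (\<Sum>S\<in>negations. G S + (if e then 1 else - 1) * ((- 1) ^ card S * G S))"
    unfolding sum.inter_filter[OF finite_negations] sum_distrib_left by (intro sum.cong) auto
  also have "\<dots> = 2 * (C * (\<Prod>i=max 1 (\<mu> 1)..<n. 1 + q ^ i))"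
    unfolding sum.distrib sum_distrib_left[symmetric] plus minus by simp
  finally have "(\<Sum>S | S \<in> negations \<and> (even (card S) \<longleftrightarrow> e). G S) = C * (\<Prod>i=max 1 (\<mu> 1)..<n. 1 + q ^ i)"
    using two by simp
  then show ?thesis by (simp only: G_def C_def)
qed

text \<open>\<open>e\<close> selects the coset: even for \<open>D_group\<close>, odd for its
  complement, which enters after the sign change of the value \<open>1\<close>. The assumption
  \<open>\<mu> 1 \<noteq> 1\<close> rules out a first block that contains \<open>1\<close> but not
  \<open>2\<close>.\<close>

theorem sum_B_group_parity:
  fixes q :: "'q::field"
  assumes nz: "\<And>k. k > 0 \<Longrightarrow> q_int q k \<noteq> 0" and two: "(2::'q) \<noteq> 0" and "n \<ge> 2" "\<mu> 1 \<noteq> 1"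
  defines "F \<equiv> q_fact q n / (\<Prod>j\<le>t. q_fact q (\<mu> (Suc j) - \<mu> j)) * (\<Prod>i=max 1 (\<mu> 1)..<n. 1 + q ^ i)"
  shows "(\<Sum>\<beta> | \<beta> \<in> B_group n \<and> Des_D n (inv \<beta>) \<subseteq> \<mu> ` {1..t} \<and> (even (card (negated n \<beta>)) \<longleftrightarrow> e). q ^ dmaj n \<beta>) = F"
    and "(\<Sum>\<beta> | \<beta> \<in> B_group n \<and> Des_D n (inv \<beta>) \<subseteq> \<mu> ` {1..t} \<and> (even (card (negated n \<beta>)) \<longleftrightarrow> e). q ^ length_D n \<beta>) = F"
proof -
  note parity = sum_negations_parity[OF nz two assms(3), of e]
  have "(\<Sum>w\<in>block_words (signed_label \<mu>) (signed_values n S). q ^ list_maj w) =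
      block_multinomial q {- int t..int t} (signed_label \<mu>) (signed_values n S)" for S
    by (rule sum_list_maj_block_words[OF nz _ finite_signed_values signed_label_mono signed_label_range]) auto
  from sum_B_group_eq_sum_negations[OF assms(3,4) this, where P = "\<lambda>S. even (card S) \<longleftrightarrow> e"]
  show "(\<Sum>\<beta> | \<beta> \<in> B_group n \<and> Des_D n (inv \<beta>) \<subseteq> \<mu> ` {1..t} \<and> (even (card (negated n \<beta>)) \<longleftrightarrow> e). q ^ dmaj n \<beta>) = F"
    unfolding F_def dmaj_def maj_eq_list_maj by (rule trans[OF _ parity])
  have "(\<Sum>w\<in>block_words (signed_label \<mu>) (signed_values n S). q ^ list_inv w) =
      block_multinomial q {- int t..int t} (signed_label \<mu>) (signed_values n S)" for S
    by (rule sum_list_inv_block_words[OF nz _ finite_signed_values signed_label_mono signed_label_range]) auto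
  from sum_B_group_eq_sum_negations[OF assms(3,4) this, where P = "\<lambda>S. even (card S) \<longleftrightarrow> e"]
  show "(\<Sum>\<beta> | \<beta> \<in> B_group n \<and> Des_D n (inv \<beta>) \<subseteq> \<mu> ` {1..t} \<and> (even (card (negated n \<beta>)) \<longleftrightarrow> e). q ^ length_D n \<beta>) = F"
    unfolding F_def length_D_def inversion_number_eq_list_inv by (rule trans[OF _ parity])
qed

end

section \<open>Changing the sign of the value 1\<close>

definition flip_one :: "(int \<Rightarrow> int) \<Rightarrow> int \<Rightarrow> int" where
  "flip_one \<beta> = transpose 1 (- 1) \<circ> \<beta>"

lemma transpose_minus: "transpose 1 (- 1) (- x :: int) = - transpose 1 (- 1) x"
  by (auto simp: transpose_def)

text \<open>\<open>1\<close> and \<open>- 1\<close> are neighbours among the nonzero integers, so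
  exchanging them changes no comparison with other letters.\<close>

lemma transpose_less_iff:
  fixes x y :: int
  assumes "x \<noteq> 0" "y \<noteq> 0" "\<bar>x\<bar> \<noteq> \<bar>y\<bar>"
  shows "transpose 1 (- 1) x < transpose 1 (- 1) y \<longleftrightarrow> x < y"
  using assms unfolding transpose_def by auto

text \<open>The sign of the sum is that of the summand of greater absolute value, which is at least
  \<open>2\<close> in absolute value and hence fixed by the exchange.\<close>

lemma transpose_add_less_iff:
  fixes x y :: int
  assumes "x \<noteq> 0" "y \<noteq> 0" "\<bar>x\<bar> \<noteq> \<bar>y\<bar>"
  shows "transpose 1 (- 1) x + transpose 1 (- 1) y < 0 \<longleftrightarrow> x + y < 0"
  using assms unfolding transpose_def by auto

lemma flip_one_flip_one [simp]: "flip_one (flip_one \<beta>) = \<beta>"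
  by (auto simp: flip_one_def fun_eq_iff)

lemma flip_one_B_group:
  assumes "\<beta> \<in> B_group n" "n \<ge> 1"
  shows "flip_one \<beta> \<in> B_group n"
proof -
  have "transpose 1 (- 1) permutes ({- int n..int n} - {0})"
    using assms(2) by (intro permutes_swap_id) auto
  then show ?thesis
    using assms(1) B_group_odd[OF assms(1)]
    by (auto simp: B_group_def flip_one_def transpose_minus intro: permutes_compose)
qed

lemma inv_flip_one:
  assumes "\<beta> \<in> B_group n"
  shows "inv (flip_one \<beta>) = inv \<beta> \<circ> transpose 1 (- 1)"
  unfolding flip_one_def by (subst o_inv_distrib) (auto simp: B_group_bij[OF assms])

lemma flip_one_less_iff:
  assumes "\<beta> \<in> B_group n" "i \<in> {1..n}" "j \<in> {1..n}" "i \<noteq> j"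
  shows "flip_one \<beta> (int i) < flip_one \<beta> (int j) \<longleftrightarrow> \<beta> (int i) < \<beta> (int j)"
    and "flip_one \<beta> (int i) + flip_one \<beta> (int j) < 0 \<longleftrightarrow> \<beta> (int i) + \<beta> (int j) < 0"
proof -
  have "\<beta> (int i) \<noteq> 0" "\<beta> (int j) \<noteq> 0"
    using B_group_range[OF assms(1), of "int i"] B_group_range[OF assms(1), of "int j"] assms(2,3) by auto
  moreover have "\<bar>\<beta> (int i)\<bar> \<noteq> \<bar>\<beta> (int j)\<bar>"
    using B_group_abs_eq_iff[OF assms(1)] assms(4) by simp
  ultimately show "flip_one \<beta> (int i) < flip_one \<beta> (int j) \<longleftrightarrow> \<beta> (int i) < \<beta> (int j)"
    and "flip_one \<beta> (int i) + flip_one \<beta> (int j) < 0 \<longleftrightarrow> \<beta> (int i) + \<beta> (int j) < 0"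
    unfolding flip_one_def o_def by (rule transpose_less_iff transpose_add_less_iff)+
qed

lemma N2_flip_one:
  assumes "\<beta> \<in> B_group n"
  shows "N2 n (flip_one \<beta>) = N2 n \<beta>"
  unfolding N2_def using flip_one_less_iff(2)[OF assms] by (simp cong: conj_cong)

lemma dmaj_flip_one:
  assumes "\<beta> \<in> B_group n"
  shows "dmaj n (flip_one \<beta>) = dmaj n \<beta>"
proof -
  have "flip_one \<beta> (int (i + 1)) < flip_one \<beta> (int i) \<longleftrightarrow> \<beta> (int (i + 1)) < \<beta> (int i)" if "i \<in> {1..n - 1}" for i
    using that by (intro flip_one_less_iff[OF assms]) auto
  then have "Des n (flip_one \<beta>) = Des n \<beta>"
    unfolding Des_def by blast
  then show ?thesis by (simp add: dmaj_def maj_def N2_flip_one[OF assms])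
qed

lemma length_D_flip_one:
  assumes "\<beta> \<in> B_group n"
  shows "length_D n (flip_one \<beta>) = length_D n \<beta>"
proof -
  have "flip_one \<beta> (int j) < flip_one \<beta> (int i) \<longleftrightarrow> \<beta> (int j) < \<beta> (int i)" if "1 \<le> i" "i < j" "j \<le> n" for i j
    using that by (intro flip_one_less_iff[OF assms]) auto
  then have "{(i, j). 1 \<le> i \<and> i < j \<and> j \<le> n \<and> flip_one \<beta> (int j) < flip_one \<beta> (int i)} =
    {(i, j). 1 \<le> i \<and> i < j \<and> j \<le> n \<and> \<beta> (int j) < \<beta> (int i)}" by blast
  then show ?thesis by (simp add: length_D_def inversion_number_def N2_flip_one[OF assms])
qed

text \<open>The inverse \<open>p\<close> changes sign at the argument \<open>1\<close>. This
  exchanges the conditions \<open>- p 2 > p 1\<close> and \<open>p 1 > p 2\<close> and leaves all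
  later ones alone.\<close>

lemma Des_D_flip_one:
  assumes "\<beta> \<in> B_group n" "n \<ge> 2"
  shows "Des_D n (inv (flip_one \<beta>)) = transpose 0 1 ` Des_D n (inv \<beta>)"
proof -
  let ?p = "inv \<beta>"
  have odd: "?p (- x) = - ?p x" for x
    using B_group_odd[OF B_group_inv[OF assms(1)]] .
  have flip: "inv (flip_one \<beta>) x = (if \<bar>x\<bar> = 1 then - ?p x else ?p x)" for x
    unfolding inv_flip_one[OF assms(1)] using odd[of 1] by (auto simp: transpose_def abs_if)
  have "i \<in> Des_D n (inv (flip_one \<beta>)) \<longleftrightarrow> transpose 0 1 i \<in> Des_D n ?p" for i
  proof -
    consider "i = 0" | "i = 1" | "i \<ge> 2" by linarith
    then show ?thesis
      using assms(2) by cases (auto simp: Des_D_def flip)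
  qed
  moreover have "i \<in> transpose 0 1 ` Des_D n ?p" if "transpose 0 1 i \<in> Des_D n ?p" for i
    using that by (intro image_eqI[of _ _ "transpose 0 1 i"]) auto
  ultimately show ?thesis by auto
qed

text \<open>The two sets of negated values differ exactly in the element \<open>1\<close>.\<close>

lemma even_card_negated_flip_one:
  assumes "\<beta> \<in> B_group n" "n \<ge> 1"
  shows "even (card (negated n (flip_one \<beta>))) \<longleftrightarrow> odd (card (negated n \<beta>))"
proof -
  let ?A = "negated n \<beta>" and ?B = "negated n (flip_one \<beta>)"
  have "inv \<beta> (- 1) = - inv \<beta> 1" "inv \<beta> 1 \<noteq> 0"
    using B_group_odd[OF B_group_inv[OF assms(1)], of 1] B_group_range[OF B_group_inv[OF assms(1)], of 1] assms(2)
    by auto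
  then have one: "1 \<in> ?B \<longleftrightarrow> 1 \<notin> ?A"
    using assms(2) by (auto simp: negated_def inv_flip_one[OF assms(1)])
  have "inv (flip_one \<beta>) (int b) = inv \<beta> (int b)" if "b \<noteq> 1" for b
    using that by (auto simp: inv_flip_one[OF assms(1)] transpose_def)
  then have rest: "?B - {1} = ?A - {1}"
    by (auto simp: negated_def)
  define k where "k = card (?A - {1})"
  have "card X = card (X - {1}) + of_bool (1 \<in> X)" if "finite X" for X :: "nat set"
    using that card.remove[of X 1] by (cases "1 \<in> X") auto
  moreover have "finite (negated n \<beta>')" for \<beta>'
    by (simp add: negated_def)
  ultimately have "card ?A = card (?A - {1}) + of_bool (1 \<in> ?A)" "card ?B = card (?B - {1}) + of_bool (1 \<in> ?B)"
    by blast+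
  then have "card ?A = k + of_bool (1 \<in> ?A)" "card ?B = k + of_bool (1 \<notin> ?A)"
    unfolding rest one k_def .
  then show ?thesis by (cases "1 \<in> ?A") simp_all
qed

text \<open>The equivalence with \<open>True\<close> gives the set the shape found in
  \<open>sum_B_group_parity\<close> for \<open>e = True\<close>.\<close>

lemma D_of_eq:
  "D_of n M = {\<beta>. \<beta> \<in> B_group n \<and> Des_D n (inv \<beta>) \<subseteq> M \<and> (even (card (negated n \<beta>)) \<longleftrightarrow> True)}"
  by (auto simp: D_of_def D_group_def card_negated)

text \<open>Changing the sign of \<open>1\<close> exchanges the descents \<open>0\<close> and \<open>1\<close> of the inverse and swaps the two cosets of
  \<open>D_n\<close> in \<open>B_n\<close>.\<close>

lemma sum_D_of_flip_one:
  fixes h :: "(int \<Rightarrow> int) \<Rightarrow> 'q::comm_monoid_add"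
  assumes "n \<ge> 2" "0 \<notin> M" "1 \<in> M" "\<And>\<beta>. \<beta> \<in> B_group n \<Longrightarrow> h (flip_one \<beta>) = h \<beta>"
  shows "(\<Sum>\<beta>\<in>D_of n M. h \<beta>) =
    (\<Sum>\<beta> | \<beta> \<in> B_group n \<and> Des_D n (inv \<beta>) \<subseteq> insert 0 (M - {1}) \<and> (even (card (negated n \<beta>)) \<longleftrightarrow> False). h \<beta>)"
proof -
  have img: "transpose 0 1 ` A \<subseteq> insert 0 (M - {1}) \<longleftrightarrow> A \<subseteq> M" for A
  proof -
    have "transpose 0 1 x \<in> insert 0 (M - {1}) \<longleftrightarrow> x \<in> M" for x :: nat
      using assms(2,3) by (auto simp: transpose_def)
    then show ?thesis unfolding image_subset_iff by (simp only: subset_eq)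
  qed
  have img': "transpose 0 1 ` A \<subseteq> M \<longleftrightarrow> A \<subseteq> insert 0 (M - {1})" for A
    using img[of "transpose 0 1 ` A"] by (simp add: image_comp)
  define M' where "M' = insert 0 (M - {1})"
  have "Des_D n (inv (flip_one \<beta>)) \<subseteq> M' \<longleftrightarrow> Des_D n (inv \<beta>) \<subseteq> M"
    "Des_D n (inv (flip_one \<beta>)) \<subseteq> M \<longleftrightarrow> Des_D n (inv \<beta>) \<subseteq> M'" if "\<beta> \<in> B_group n" for \<beta>
    unfolding M'_def Des_D_flip_one[OF that assms(1)] by (rule img img')+
  then show ?thesis
    unfolding D_of_eq M'_def[symmetric] using assms(1,4)
    by (intro sum.reindex_bij_witness[of _ flip_one flip_one])
      (simp_all add: flip_one_B_group even_card_negated_flip_one)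
qed

section \<open>The generating functions\<close>

lemma q_var_power: "q_var ^ i = Fract ([:0, 1:] ^ i) 1"
  by (induction i) (simp_all add: q_var_def One_fract_def)

lemma q_int_q_var: "q_int q_var k = Fract (\<Sum>i<k. [:0, 1:] ^ i) 1"
  by (induction k) (simp_all add: q_int_def q_var_power Zero_fract_def)

lemma q_int_q_var_nonzero:
  assumes "k > 0"
  shows "q_int q_var k \<noteq> 0"
proof -
  \<comment> \<open>The value at \<open>1\<close> shows that the polynomial is nonzero.\<close>
  have "poly (\<Sum>i<k. [:0, 1:] ^ i) (1::int) = int k"
    by (simp add: poly_sum)
  then have "(\<Sum>i<k. [:0, 1::int:] ^ i) \<noteq> 0"
    using assms by auto
  then show ?thesis
    by (simp add: q_int_q_var Zero_fract_def eq_fract)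
qed

text \<open>Permits the halving in the parity argument.\<close>

lemma two_fract_nonzero: "(2 :: int poly fract) \<noteq> 0"
proof -
  have "(2 :: int poly fract) = Fract (1 + 1) 1"
    unfolding one_add_one[symmetric, where 'a = "int poly fract"] One_fract_def by simp
  then show ?thesis
    unfolding Zero_fract_def by (simp only: eq_fract) simp
qed

lemma q_multinomial_Cons_map:
  "q_multinomial q n (a # map f [1..<t + 1]) = q_fact q n / (q_fact q a * (\<Prod>j=1..t. q_fact q (f j)))"
proof -
  have "(\<Prod>x\<leftarrow>[1..<t + 1]. q_fact q (f x)) = (\<Prod>j\<in>set [1..<t + 1]. q_fact q (f j))"
    by (rule prod.distinct_set_conv_list[symmetric]) simp
  also have "set [1..<t + 1] = {1..t}" by auto
  finally show ?thesis by (simp add: q_multinomial_def o_def del: upt_Suc)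
qed

theorem theorem4p5:
  fixes n t :: nat and m :: "nat \<Rightarrow> nat" and M :: "nat set"
  assumes "n \<ge> 2"
    and "M \<subseteq> {0..n-1}"
    and "M = m ` {1..t}"
    and "strict_mono_on {1..t} m"
    and "m (t + 1) = n"
  shows "let q = q_var;
             C = q_multinomial q n (m 1 # map (\<lambda>i. m (i + 1) - m i) [1..<t + 1])
         in (\<Sum>\<gamma>\<in>D_of n M. q ^ dmaj n \<gamma>) = (\<Sum>\<gamma>\<in>D_of n M. q ^ length_D n \<gamma>) \<and>
            (\<Sum>\<gamma>\<in>D_of n M. q ^ length_D n \<gamma>) =
              (if 0 \<in> M then C * (\<Prod>i=1..n-1. 1 + q ^ i)
               else if 1 \<notin> M then C * (\<Prod>i=m 1..n-1. 1 + q ^ i)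
               else C * ((\<Prod>i=1..n-1. 1 + q ^ i) / q_int q (m 2)))"
proof -
  define C where "C = q_fact q_var n / (q_fact q_var (m 1) * (\<Prod>j=1..t. q_fact q_var (m (Suc j) - m j)))"
  have C: "q_multinomial q_var n (m 1 # map (\<lambda>i. m (i + 1) - m i) [1..<t + 1]) = C"
    by (subst q_multinomial_Cons_map) (simp add: C_def)
  have m_step: "m j < m (Suc j)" if "1 \<le> j" "j \<le> t" for j
  proof (cases "j = t")
    case True
    then have "m j \<in> M" using that assms(3) by auto
    then have "m j < n" using assms(1,2) by auto
    then show ?thesis using True assms(5) by simp
  next
    case False
    then show ?thesis using that assms(4) by (auto simp: strict_mono_on_def)
  qed
  have m1_le: "m 1 \<le> x" if "x \<in> M" for x
    using that assms(3,4) by (auto simp: strict_mono_on_def) (metis atLeastAtMost_iff le_less le_trans order.refl)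
  have m1_mem: "m 1 \<in> M" if "t \<ge> 1"
    using that assms(3) by auto
  have t_pos: "t \<ge> 1" if "M \<noteq> {}"
    using that assms(3) by (cases t) auto
  have upper: "{a..n - 1} = {a..<n}" for a
    using assms(1) by auto
  have split0: "{..t} = insert 0 {1..t}" by auto
  define G where "G = (if 0 \<in> M then C * (\<Prod>i=1..n-1. 1 + q_var ^ i)
               else if 1 \<notin> M then C * (\<Prod>i=m 1..n-1. 1 + q_var ^ i)
               else C * ((\<Prod>i=1..n-1. 1 + q_var ^ i) / q_int q_var (m 2)))"
  have "(\<Sum>\<gamma>\<in>D_of n M. q_var ^ dmaj n \<gamma>) = G \<and> (\<Sum>\<gamma>\<in>D_of n M. q_var ^ length_D n \<gamma>) = G"
  proof (cases "0 \<notin> M \<and> 1 \<in> M")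
    case False
    \<comment> \<open>The value \<open>m 0\<close> is arbitrary; the first block has to start at
      \<open>0\<close>.\<close>
    define \<mu> where "\<mu> = m(0 := 0)"
    interpret block_structure n t \<mu>
      by unfold_locales (use m_step assms(5) in \<open>auto simp: \<mu>_def\<close>)
    \<comment> \<open>\<open>m 1 = 1\<close> would mean \<open>1 \<in> M\<close> and
      \<open>0 \<notin> M\<close>, the case treated separately; for \<open>t = 0\<close> one has
      \<open>m 1 = n \<ge> 2\<close>.\<close>
    have "m 1 \<noteq> 1"
    proof
      assume "m 1 = 1"
      then have "t \<noteq> 0" using assms(1,5) by (intro notI) simp
      then have "1 \<in> M" using m1_mem \<open>m 1 = 1\<close> by simp
      then show False using False m1_le[of 0] \<open>m 1 = 1\<close> by auto
    qed
    then have mu1: "\<mu> 1 \<noteq> 1" by (simp add: \<mu>_def)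
    have M: "M = \<mu> ` {1..t}" using assms(3) by (auto simp: \<mu>_def)
    have "q_fact q_var n / (\<Prod>j\<le>t. q_fact q_var (\<mu> (Suc j) - \<mu> j)) * (\<Prod>i=max 1 (\<mu> 1)..<n. 1 + q_var ^ i) = G"
    proof -
      have "(\<Prod>j\<le>t. q_fact q_var (\<mu> (Suc j) - \<mu> j)) = q_fact q_var (m 1) * (\<Prod>j=1..t. q_fact q_var (m (Suc j) - m j))"
        by (simp add: split0 \<mu>_def)
      moreover have "m 1 = 0 \<longleftrightarrow> 0 \<in> M"
        using m1_le[of 0] m1_mem assms(1,5) by (cases t) auto
      ultimately show ?thesis
        using False \<open>m 1 \<noteq> 1\<close> unfolding G_def upper by (auto simp: C_def \<mu>_def max_def)
    qed
    then show ?thesis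
      using sum_B_group_parity[OF q_int_q_var_nonzero two_fract_nonzero assms(1) mu1, of True]
      by (simp only: D_of_eq M)
  next
    case True
    then have t: "t \<ge> 1" using t_pos by auto
    have m1: "m 1 = 1" using m1_le[of 1] m1_mem[OF t] True by (cases "m 1 = 0") auto
    \<comment> \<open>The sign change turns the allowed descents into
      \<open>insert 0 (M - {1})\<close>: the boundary \<open>m 1 = 1\<close> moves to
      \<open>0\<close>, so the first block is empty and the next one is
      \<open>{1..m 2}\<close>.\<close>
    define \<mu> where "\<mu> = m(0 := 0, 1 := 0)"
    interpret block_structure n t \<mu>
    proof
      show "\<mu> j < \<mu> (Suc j)" if "1 \<le> j" "j \<le> t" for j
        using m_step[OF that] that by (auto simp: \<mu>_def)
    qed (use t assms(5) in \<open>auto simp: \<mu>_def\<close>)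
    have M: "insert 0 (M - {1}) = \<mu> ` {1..t}"
    proof -
      have s: "{1..t} = insert 1 {2..t}" using t by auto
      have "m j \<noteq> 1" if "j \<in> {2..t}" for j
        using strict_mono_onD[OF assms(4), of 1 j] that m1 by auto
      then have "M - {1} = m ` {2..t}" unfolding assms(3) s using m1 by auto
      moreover have "\<mu> ` {1..t} = insert 0 (m ` {2..t})" unfolding s by (auto simp: \<mu>_def)
      ultimately show ?thesis by simp
    qed
    have "q_fact q_var n / (\<Prod>j\<le>t. q_fact q_var (\<mu> (Suc j) - \<mu> j)) * (\<Prod>i=max 1 (\<mu> 1)..<n. 1 + q_var ^ i) = G"
    proof -
      \<comment> \<open>Merging the blocks \<open>{1}\<close> and \<open>{2..m 2}\<close> replaces
        the q-factorial of \<open>m 2 - 1\<close> in the denominator by that of \<open>m 2\<close>;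
        this is the origin of the division by \<open>q_int q (m 2)\<close>.\<close>
      obtain c where c: "m 2 = Suc c" using m_step[of 1] t by (cases "m 2") (auto simp: numeral_2_eq_2)
      have s: "{1..t} = insert 1 {2..t}" using t by auto
      have "(\<Prod>j\<le>t. q_fact q_var (\<mu> (Suc j) - \<mu> j)) = q_fact q_var (m 2) * (\<Prod>j=2..t. q_fact q_var (m (Suc j) - m j))"
        unfolding split0 s by (simp add: \<mu>_def numeral_2_eq_2)
      moreover have "C = q_fact q_var n / (q_fact q_var c * (\<Prod>j=2..t. q_fact q_var (m (Suc j) - m j)))"
        unfolding C_def s using c m1 by (simp add: numeral_2_eq_2 q_fact_Suc q_int_Suc)
      ultimately show ?thesis
        using True unfolding G_def upper by (simp add: c q_fact_Suc \<mu>_def)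
    qed
    moreover have "\<mu> 1 \<noteq> 1" by (simp add: \<mu>_def)
    ultimately show ?thesis
      using sum_B_group_parity[OF q_int_q_var_nonzero two_fract_nonzero assms(1), of False] True
        sum_D_of_flip_one[OF assms(1), of M "\<lambda>\<beta>. q_var ^ dmaj n \<beta>"]
        sum_D_of_flip_one[OF assms(1), of M "\<lambda>\<beta>. q_var ^ length_D n \<beta>"]
      by (simp add: M dmaj_flip_one length_D_flip_one del: One_nat_def)
  qed
  then show ?thesis
    by (simp only: Let_def C G_def)
qed

end
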